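(* Let $n \geq 3$ and let $\vec{\alpha}=(\alpha_1,\dots,\alpha_n) \in \mathbb{R}^n$ satisfy $\alpha_j^{-1} = \alpha + q_j$ for all $1\le j\le n$, for some $\vec{q}=(q_1,\dots,q_n) \in \mathbb{Q}^n$ and some $\alpha \in \mathbb{R}$ such that $q_i \neq q_j$ whenever $i \neq j$ and $q_j \neq -\alpha$ for all $1 \leq j \leq n$. Then the operator defined a priori on $\mathcal{S}(\mathbb{R})^n$ by $$ nC^{\vec{\alpha}} (\vec{f})(x) = \sup_{M \in \mathbb{R}} \left| \int_{\{\vec{\xi}\in\mathbb{R}^n:\ \vec{\xi} \cdot \vec{\alpha} >0,\ \xi_n < M\}} \left[ \prod_{j=1}^n \hat{f}_j(\xi_j) e^{2 \pi i x \xi_j }\right] d\xi_1 \cdots d\xi_n \right| $$ satisfies no $L^p$ estimates.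
   Context: $\mathcal{S}(\mathbb{R})$ is the Schwartz class on $\mathbb{R}$ and $\hat f(\xi)=\int_{\mathbb{R}} f(x)e^{-2\pi i x\xi}\,dx$. An $n$-(sub)linear operator $T$ defined a priori on $\mathcal{S}(\mathbb{R})^n$ "satisfies no $L^p$ estimates" if there does not exist any $n$-tuple $\vec p=(p_1,\dots,p_n)\in[1,\infty]^n$ for which there is a constant $C_{T,\vec p}$ such that $\|T(\vec f)\|_{p} \le C_{T,\vec p}\prod_{j=1}^n \|f_j\|_{p_j}$ for all $\vec f=(f_1,\dots,f_n)\in\mathcal{S}(\mathbb{R})^n$, where $\frac1p=\sum_{j=1}^n\frac1{p_j}$ (with $1/\infty=0$). *)

theory Defs
  imports "HOL-Probability.Essential_Supremum"
begin

definition vderiv :: "nat \<Rightarrow> (real \<Rightarrow> complex) \<Rightarrow> real \<Rightarrow> complex" where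
  "vderiv k = ((\<lambda>g x. vector_derivative g (at x)) ^^ k)"

definition schwartz :: "(real \<Rightarrow> complex) \<Rightarrow> bool" where
  "schwartz f \<longleftrightarrow>
     (\<forall>k x. vderiv k f differentiable at x) \<and>
     (\<forall>k m. bounded (range (\<lambda>x. x ^ m *\<^sub>R vderiv k f x)))"

definition fourier :: "(real \<Rightarrow> complex) \<Rightarrow> real \<Rightarrow> complex" where
  "fourier f \<xi> = (LINT x|lborel. f x * exp (- 2 * complex_of_real pi * \<i> * of_real x * of_real \<xi>))"

(* Only used with r > 0. *)
definition enn_powr :: "ennreal \<Rightarrow> real \<Rightarrow> ennreal" where
  "enn_powr u r = (if u = \<infinity> then \<infinity> else ennreal (enn2real u powr r))"

(* The L^p (quasi-)norm on the line of a function with values in [0, infinity],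
   for 0 < p <= infinity; exponents below 1 do occur as target exponents. *)
definition Lp_norm :: "ennreal \<Rightarrow> (real \<Rightarrow> ennreal) \<Rightarrow> ennreal" where
  "Lp_norm p F =
     (if p = \<infinity> then esssup lborel F
      else enn_powr (\<integral>\<^sup>+ x. enn_powr (F x) (enn2real p) \<partial>lborel) (1 / enn2real p))"

(* T f x stands for the modulus of the value of the operator at x.  The tuples are indexed
   by 1, ..., n and their entries elsewhere are irrelevant.  In ennreal 1 / infinity = 0 and
   1 / 0 = infinity, so the target exponent is infinity iff all p j are. *)
definition satisfies_no_Lp_estimates ::
    "nat \<Rightarrow> ((nat \<Rightarrow> real \<Rightarrow> complex) \<Rightarrow> real \<Rightarrow> ennreal) \<Rightarrow> bool" where
  "satisfies_no_Lp_estimates n T \<longleftrightarrow>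
     \<not> (\<exists>p :: nat \<Rightarrow> ennreal. (\<forall>j\<in>{1..n}. 1 \<le> p j) \<and>
          (\<exists>C :: real. \<forall>f. (\<forall>j\<in>{1..n}. schwartz (f j)) \<longrightarrow>
             Lp_norm (1 / (\<Sum>j=1..n. 1 / p j)) (T f)
               \<le> ennreal C * (\<Prod>j=1..n. Lp_norm (p j) (\<lambda>x. ennreal (cmod (f j x))))))"

(* Lebesgue measure on R^n, with R^n realised as the functions on {1..n}. *)
abbreviation lborel_n :: "nat \<Rightarrow> (nat \<Rightarrow> real) measure" where
  "lborel_n n \<equiv> Pi\<^sub>M {1..n} (\<lambda>_. lborel)"

(* The supremum is taken in [0, infinity], so no boundedness in M is presupposed. *)
definition nC :: "nat \<Rightarrow> (nat \<Rightarrow> real) \<Rightarrow> (nat \<Rightarrow> real \<Rightarrow> complex) \<Rightarrow> real \<Rightarrow> ennreal" where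
  "nC n \<alpha> f x =
     (SUP M :: real. ennreal (cmod
        (LINT \<xi>:{\<xi> \<in> space (lborel_n n). (\<Sum>j=1..n. \<xi> j * \<alpha> j) > 0 \<and> \<xi> n < M}|lborel_n n.
           (\<Prod>j=1..n. fourier (f j) (\<xi> j) *
              exp (2 * complex_of_real pi * \<i> * of_real x * of_real (\<xi> j))))))"

end

theory Submission
  imports Defs "HOL-Probability.Characteristic_Functions" "HOL-Complex_Analysis.Conformal_Mappings"
    "HOL-Real_Asymp.Real_Asymp"
begin

text \<open>
  Test the operator on the chirps \<open>f\<^sub>j(y) = exp (- \<pi> (1 - i L c\<^sub>j) y\<^sup>2)\<close>, where \<open>c\<^sub>n = 1\<close>,
  \<open>\<Sum> c\<^sub>j \<alpha>\<^sub>j = 0\<close> and \<open>\<Sum> c\<^sub>j \<alpha>\<^sub>j\<^sup>2 = 0\<close>. The moduli do not depend on \<open>L\<close>, and along the line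
  \<open>t \<mapsto> (x + \<alpha>\<^sub>j t)\<^sub>j\<close> the quadratic phases cancel, so that the multiplier \<open>1\<^bsub>\<xi>\<bullet>\<alpha> > 0\<^esub>\<close>, whose kernel
  is essentially \<open>1/t\<close>, sees a positive function. The cut-off \<open>\<xi>\<^sub>n < M\<close> in frequency acts on the
  chirp \<open>f\<^sub>n\<close> like a cut-off in space at \<open>M/L\<close>, sharp up to the scale \<open>L\<^bsup>-1/2\<^esup>\<close>; with \<open>M = L x\<close> it
  destroys the cancellation between \<open>t < 0\<close> and \<open>t > 0\<close>, and the operator is at least of
  order \<open>\<integral> dt/t \<approx> ln L\<close> over \<open>L\<^bsup>-1/2\<^esup> < t < 1\<close>, for all \<open>x\<close> in \<open>[0, 1]\<close>. Letting \<open>L \<rightarrow> \<infinity>\<close>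
  refutes every estimate.

  To make this exact, the cut-off in space is taken to be a Gaussian step with real parameter. On the
  frequency side it becomes multiplication by an error function along a line in the complex plane,
  which has variation bounded uniformly in \<open>L\<close> and is therefore a superposition of the cut-offs
  \<open>\<xi>\<^sub>n < M\<close>.
\<close>

section \<open>Complex Gaussians and chirps\<close>

lemma integrable_real_gaussian:
  fixes c d :: real
  assumes "c > 0"
  shows "integrable lborel (\<lambda>y. exp (- c * y\<^sup>2 + d * y))"
proof -
  \<comment> \<open>Completing the square gives a multiple of the normal density with mean
    \<open>d / (2 * c)\<close> and variance \<open>1 / (2 * c)\<close>.\<close>
  have s: "(1 / sqrt (2 * c))\<^sup>2 = 1 / (2 * c)"
    using assms by (simp add: power_divide)
  have "integrable lborel (\<lambda>y. (sqrt (pi / c) * exp (d\<^sup>2 / (4 * c))) *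
      normal_density (d / (2 * c)) (1 / sqrt (2 * c)) y)"
    using assms by (intro integrable_mult_right integrable_normal_density) simp
  also have "(\<lambda>y. (sqrt (pi / c) * exp (d\<^sup>2 / (4 * c))) *
      normal_density (d / (2 * c)) (1 / sqrt (2 * c)) y) = (\<lambda>y. exp (- c * y\<^sup>2 + d * y))"
  proof
    fix y :: real
    have e: "d\<^sup>2 / (4 * c) + - (y - d / (2 * c))\<^sup>2 / (2 * (1 / (2 * c))) = - c * y\<^sup>2 + d * y"
      using assms by (simp add: field_simps power2_eq_square)
    have sq: "sqrt (pi / c) * (1 / sqrt (2 * pi * (1 / (2 * c)))) = 1"
      using assms by simp
    have "sqrt (pi / c) * exp (d\<^sup>2 / (4 * c)) * normal_density (d / (2 * c)) (1 / sqrt (2 * c)) y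
      = (sqrt (pi / c) * (1 / sqrt (2 * pi * (1 / (2 * c))))) *
        exp (d\<^sup>2 / (4 * c) + - (y - d / (2 * c))\<^sup>2 / (2 * (1 / (2 * c))))"
      unfolding normal_density_def s exp_add by simp
    then show "sqrt (pi / c) * exp (d\<^sup>2 / (4 * c)) * normal_density (d / (2 * c)) (1 / sqrt (2 * c)) y
      = exp (- c * y\<^sup>2 + d * y)"
      unfolding sq e by simp
  qed
  finally show ?thesis .
qed

text \<open>The linear coefficient \<open>b\<close> is complex so that the family is closed under
  translation, modulation and Fourier phases: a phase at frequency \<xi> only moves \<open>b\<close>
  to \<open>b - \<i> * \<xi>\<close>.\<close>

definition gauss :: "complex \<Rightarrow> complex \<Rightarrow> real \<Rightarrow> complex" where
  "gauss a b y = exp (- of_real pi * a * (of_real y)\<^sup>2 + 2 * of_real pi * b * of_real y)"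

lemma norm_gauss: "cmod (gauss a b y) = exp (- (pi * Re a) * y\<^sup>2 + (2 * pi * Re b) * y)"
  unfolding gauss_def norm_exp_eq_Re by (simp add: power2_eq_square)

lemma continuous_on_gauss [continuous_intros]: "continuous_on A (gauss a b)"
  unfolding gauss_def by (intro continuous_intros)

lemma borel_measurable_gauss [measurable]: "gauss a b \<in> borel_measurable borel"
  by (intro borel_measurable_continuous_onI continuous_intros)

lemma integrable_gauss:
  assumes "Re a > 0"
  shows "integrable lborel (gauss a b)"
proof (rule Bochner_Integration.integrable_bound)
  show "integrable lborel (\<lambda>y. exp (- (pi * Re a) * y\<^sup>2 + (2 * pi * Re b) * y))"
    using assms by (intro integrable_real_gaussian) simp
qed (auto simp: norm_gauss)

text \<open>For real width this is the characteristic function of the standard normal law after an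
  affine substitution: \<open>Re b\<close> becomes the centre and \<open>Im b\<close> the
  frequency.\<close>

lemma integral_gauss_real:
  fixes a :: real
  assumes "a > 0"
  shows "(LINT y|lborel. gauss (of_real a) b y) = exp (of_real pi * b\<^sup>2 / of_real a) / of_real (sqrt a)"
proof -
  \<comment> \<open>The substitution is \<open>s * (y - m)\<close> with \<open>m = Re b / a\<close>;
    \<open>s\<close> turns the standard density into width \<open>a\<close>, and
    \<open>t * s = 2 * pi * Im b\<close> matches the frequencies.\<close>
  define t where "t = sqrt (2 * pi / a) * Im b"
  define s where "s = sqrt (2 * pi * a)"
  have s0: "s > 0" using assms by (simp add: s_def)
  have s2: "s\<^sup>2 = 2 * pi * a" using assms by (simp add: s_def)
  have "sqrt (2 * pi / a) * sqrt (2 * pi * a) = sqrt ((2 * pi)\<^sup>2)"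
    unfolding real_sqrt_mult[symmetric] using assms
    by (intro arg_cong[of _ _ sqrt]) (simp add: power2_eq_square)
  then have "sqrt (2 * pi / a) * sqrt (2 * pi * a) = 2 * pi"
    unfolding real_sqrt_abs by simp
  then have ts: "t * s = 2 * pi * Im b"
    by (simp add: t_def s_def)
  have t2: "t\<^sup>2 / 2 = pi * (Im b)\<^sup>2 / a"
    using assms by (simp add: t_def power_mult_distrib)
  define m where "m = Re b / a"
  have "complex_of_real (exp (- (t^2) / 2)) = char std_normal_distribution t"
    by (simp add: char_std_normal_distribution)
  also have "\<dots> = (LINT x|lborel. std_normal_density x *\<^sub>R iexp (t * x))"
    unfolding char_def by (subst integral_density) auto
  also have "\<dots> = \<bar>s\<bar> *\<^sub>R (LINT y|lborel. std_normal_density (- s * m + s * y) *\<^sub>R iexp (t * (- s * m + s * y)))"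
    using s0 by (subst lborel_integral_real_affine[where c = s and t = "- s * m"]) simp_all
  also have "(\<lambda>y. std_normal_density (- s * m + s * y) *\<^sub>R iexp (t * (- s * m + s * y)))
     = (\<lambda>y. ((1 / sqrt (2 * pi)) * exp (- (pi * (Re b)\<^sup>2 / a))) * iexp (- (2 * pi * Im b * m)) * gauss (of_real a) b y)"
  proof
    fix y :: real
    have "(- s * m + s * y)\<^sup>2 = s\<^sup>2 * (y - m)\<^sup>2"
      by (simp add: power2_eq_square algebra_simps)
    then have 1: "- (- s * m + s * y)\<^sup>2 / 2 = - pi * a * (y - m)\<^sup>2"
      unfolding s2 by simp
    have "- pi * a * (y - m)\<^sup>2 = - pi * a * y\<^sup>2 + 2 * pi * Re b * y - pi * (Re b)\<^sup>2 / a"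
      using assms unfolding m_def by (simp add: field_simps power2_eq_square)
    then have 2: "std_normal_density (- s * m + s * y) = (1 / sqrt (2 * pi)) *
        exp (- pi * a * y\<^sup>2 + 2 * pi * Re b * y + - (pi * (Re b)\<^sup>2 / a))"
      unfolding std_normal_density_def 1 by simp
    have 3: "t * (- s * m + s * y) = - (2 * pi * Im b * m) + 2 * pi * Im b * y"
      using ts by (simp add: algebra_simps)
    have 4: "gauss (of_real a) b y = exp (of_real (- pi * a * y\<^sup>2 + 2 * pi * Re b * y)) * iexp (2 * pi * Im b * y)"
      unfolding gauss_def exp_add[symmetric]
      by (rule arg_cong[of _ _ exp]) (simp add: complex_eq_iff power2_eq_square)
    show "std_normal_density (- s * m + s * y) *\<^sub>R iexp (t * (- s * m + s * y)) =
      ((1 / sqrt (2 * pi)) * exp (- (pi * (Re b)\<^sup>2 / a))) * iexp (- (2 * pi * Im b * m)) * gauss (of_real a) b y"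
      unfolding 2 3 4 by (simp add: distrib_left right_diff_distrib exp_add exp_diff exp_minus scaleR_conv_of_real
          divide_inverse mult.assoc mult.commute mult.left_commute flip: exp_of_real)
  qed
  finally have "complex_of_real (exp (- (t^2) / 2)) = s * ((1 / sqrt (2 * pi)) * exp (- (pi * (Re b)\<^sup>2 / a)) * iexp (- (2 * pi * Im b * m)) * (LINT y|lborel. gauss (of_real a) b y))"
    using s0 by (simp add: scaleR_conv_of_real)
  also have "\<dots> = of_real (s / sqrt (2 * pi)) * (exp (of_real (- (pi * (Re b)\<^sup>2 / a))) * iexp (- (2 * pi * Im b * m))) * (LINT y|lborel. gauss (of_real a) b y)"
    by (simp flip: exp_of_real)
  also have "s / sqrt (2 * pi) = sqrt a"
    using assms by (simp add: s_def real_sqrt_mult)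
  finally have "complex_of_real (sqrt a) * (exp (of_real (- (pi * (Re b)\<^sup>2 / a))) * iexp (- (2 * pi * Im b * m))) * (LINT y|lborel. gauss (of_real a) b y)
     = exp (of_real (- (t\<^sup>2 / 2)))"
    by (simp flip: exp_of_real)
  also have "\<dots> = exp (of_real (- (pi * (Re b)\<^sup>2 / a))) * iexp (- (2 * pi * Im b * m)) * exp (of_real pi * b\<^sup>2 / of_real a)"
    unfolding t2 exp_add[symmetric] m_def using assms
    by (intro arg_cong[of _ _ exp]) (simp add: complex_eq_iff power2_eq_square field_simps)
  finally have "complex_of_real (sqrt a) * (LINT y|lborel. gauss (of_real a) b y) = exp (of_real pi * b\<^sup>2 / of_real a)"
    by simp
  then show ?thesis using assms by (simp add: field_simps)
qed

text \<open>Along any sequence tending to \<open>z0\<close> the difference quotients are dominated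
  by \<open>g\<close>, by the mean value inequality on the convex ball, so dominated convergence
  applies.\<close>

lemma has_field_derivative_lebesgue_integral:
  fixes f :: "complex \<Rightarrow> real \<Rightarrow> complex"
  assumes e: "e > 0"
    and int: "\<And>z. z \<in> ball z0 e \<Longrightarrow> integrable lborel (f z)"
    and der: "\<And>z y. z \<in> ball z0 e \<Longrightarrow> ((\<lambda>z. f z y) has_field_derivative f' z y) (at z)"
    and bnd: "\<And>z y. z \<in> ball z0 e \<Longrightarrow> cmod (f' z y) \<le> g y"
    and g: "integrable lborel g"
    and meas: "f' z0 \<in> borel_measurable lborel"
  shows "((\<lambda>z. LINT y|lborel. f z y) has_field_derivative (LINT y|lborel. f' z0 y)) (at z0)"
  unfolding has_field_derivative_iff tendsto_at_iff_sequentially comp_def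
proof (intro allI impI)
  fix X :: "nat \<Rightarrow> complex"
  assume X: "\<forall>i. X i \<in> UNIV - {z0}" and lim: "X \<longlonglongrightarrow> z0"
  from lim e have "\<forall>\<^sub>F i in sequentially. X i \<in> ball z0 e"
    by (metis centre_in_ball open_ball topological_tendstoD)
  then obtain N where N: "\<And>i. i \<ge> N \<Longrightarrow> X i \<in> ball z0 e"
    by (auto simp: eventually_sequentially)
  have z0: "z0 \<in> ball z0 e" using e by simp
  have "(\<lambda>i. LINT y|lborel. (f (X (i + N)) y - f z0 y) / (X (i + N) - z0)) \<longlonglongrightarrow> (LINT y|lborel. f' z0 y)"
  proof (rule integral_dominated_convergence[where w = g])
    show "(\<lambda>y. (f (X (i + N)) y - f z0 y) / (X (i + N) - z0)) \<in> borel_measurable lborel" for i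
      using int[OF N[of "i + N"]] int[OF z0] by (auto intro!: borel_measurable_divide borel_measurable_diff)
    show "AE y in lborel. (\<lambda>i. (f (X (i + N)) y - f z0 y) / (X (i + N) - z0)) \<longlonglongrightarrow> f' z0 y"
    proof (rule AE_I2)
      fix y
      have "(\<lambda>i. (f (X i) y - f z0 y) / (X i - z0)) \<longlonglongrightarrow> f' z0 y"
        using der[OF z0, of y] X lim
        unfolding has_field_derivative_iff tendsto_at_iff_sequentially comp_def by blast
      then show "(\<lambda>i. (f (X (i + N)) y - f z0 y) / (X (i + N) - z0)) \<longlonglongrightarrow> f' z0 y"
        by (rule LIMSEQ_ignore_initial_segment)
    qed
    show "AE y in lborel. cmod ((f (X (i + N)) y - f z0 y) / (X (i + N) - z0)) \<le> g y" for i
    proof (rule AE_I2)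
      fix y
      have "cmod (f (X (i + N)) y - f z0 y) \<le> g y * cmod (X (i + N) - z0)"
      proof (rule field_differentiable_bound[where S = "ball z0 e"])
        show "((\<lambda>z. f z y) has_field_derivative f' z y) (at z within ball z0 e)" if "z \<in> ball z0 e" for z
          using der[OF that] by (rule has_field_derivative_at_within)
      qed (use bnd N[of "i + N"] z0 in auto)
      then show "cmod ((f (X (i + N)) y - f z0 y) / (X (i + N) - z0)) \<le> g y"
        using X by (simp add: norm_divide divide_le_eq)
    qed
  qed (use g meas in auto)
  also have "(\<lambda>i. LINT y|lborel. (f (X (i + N)) y - f z0 y) / (X (i + N) - z0)) =
     (\<lambda>i. ((LINT y|lborel. f (X (i + N)) y) - (LINT y|lborel. f z0 y)) / (X (i + N) - z0))"
    using int[OF N[of "_ + N"]] int[OF z0] by simp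
  finally show "(\<lambda>i. ((LINT y|lborel. f (X i) y) - (LINT y|lborel. f z0 y)) / (X i - z0)) \<longlonglongrightarrow> (LINT y|lborel. f' z0 y)"
    by (rule LIMSEQ_offset)
qed

text \<open>Both sides are holomorphic in \<open>a\<close> on the right half-plane and agree for
  real positive \<open>a\<close>, hence everywhere by the identity theorem. The principal square
  root is the right branch since it is holomorphic there.\<close>

lemma integral_gauss:
  assumes a: "Re a > 0"
  shows "(LINT y|lborel. gauss a b y) = exp (of_real pi * b\<^sup>2 / a) / csqrt a"
proof -
  define H where "H = {z. 0 < Re z}"
  define F where "F = (\<lambda>a. LINT y|lborel. gauss a b y)"
  define G where "G = (\<lambda>a. exp (of_real pi * b\<^sup>2 / a) / csqrt a)"
  have H: "open H" "connected H"
    unfolding H_def by (auto simp: open_halfspace_Re_gt convex_halfspace_Re_gt intro!: convex_connected)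
  have holF: "F holomorphic_on H"
    unfolding holomorphic_on_open[OF H(1)] F_def
  proof (intro ballI exI)
    fix z0 assume "z0 \<in> H"
    then have z0: "Re z0 > 0" by (simp add: H_def)
    define e where "e = Re z0 / 2"
    have e: "e > 0" using z0 by (simp add: e_def)
    have Re: "Re z \<ge> e" if "z \<in> ball z0 e" for z
      using that complex_Re_le_cmod[of "z0 - z"] by (simp add: dist_norm e_def)
    \<comment> \<open>Differentiating in the width produces a factor \<open>y\<^sup>2\<close>; half
      of the decay rate \<open>pi * e\<close> is spent on absorbing it, through u \<le> exp
      u.\<close>
    let ?g = "\<lambda>y. (2 / e) * exp (- (pi * e / 2) * y\<^sup>2 + (2 * pi * Re b) * y)"
    show "((\<lambda>a. LINT y|lborel. gauss a b y) has_field_derivative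
        (LINT y|lborel. - of_real pi * (of_real y)\<^sup>2 * gauss z0 b y)) (at z0)"
    proof (rule has_field_derivative_lebesgue_integral[OF e, where g = ?g])
      show "integrable lborel (gauss z b)" if "z \<in> ball z0 e" for z
        using Re[OF that] e by (intro integrable_gauss) simp
      show "((\<lambda>z. gauss z b y) has_field_derivative - of_real pi * (of_real y)\<^sup>2 * gauss z b y) (at z)" for z y
        unfolding gauss_def by (auto intro!: derivative_eq_intros)
      show "integrable lborel ?g"
        using e by (intro integrable_mult_right integrable_real_gaussian) simp
      show "cmod (- of_real pi * (of_real y)\<^sup>2 * gauss z b y) \<le> ?g y" if "z \<in> ball z0 e" for z y
      proof -
        have "pi * e / 2 * y\<^sup>2 \<le> exp (pi * e / 2 * y\<^sup>2)"
          by (rule order_trans[OF _ exp_ge_add_one_self]) simp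
        then have 1: "pi * y\<^sup>2 \<le> 2 / e * exp (pi * e / 2 * y\<^sup>2)"
          using e by (simp add: field_simps)
        have 2: "cmod (gauss z b y) \<le> exp (- (pi * e) * y\<^sup>2 + (2 * pi * Re b) * y)"
          unfolding norm_gauss using Re[OF that]
          by (auto intro!: mult_right_mono mult_left_mono)
        have "cmod (- of_real pi * (of_real y)\<^sup>2 * gauss z b y) = pi * y\<^sup>2 * cmod (gauss z b y)"
          by (simp add: norm_mult norm_power)
        also have "\<dots> \<le> (2 / e * exp (pi * e / 2 * y\<^sup>2)) * exp (- (pi * e) * y\<^sup>2 + (2 * pi * Re b) * y)"
          by (intro mult_mono 1 2) (use e in auto)
        also have "\<dots> = ?g y"
          by (simp add: mult.assoc flip: exp_add)
        finally show ?thesis .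
      qed
    qed measurable
  qed
  have holG: "G holomorphic_on H"
    unfolding G_def by (intro holomorphic_intros) (auto simp: H_def complex_nonpos_Reals_iff)
  have "F a - G a = 0"
  proof (rule analytic_continuation[where f = "\<lambda>z. F z - G z" and w = a and S = H and U = "complex_of_real ` {0<..}" and \<xi> = 1])
    show "(\<lambda>z. F z - G z) holomorphic_on H" by (intro holomorphic_intros holF holG)
    show "complex_of_real ` {0<..} \<subseteq> H" by (auto simp: H_def)
    show "1 islimpt complex_of_real ` {0<..}"
      unfolding islimpt_approachable
    proof (intro allI impI)
      fix e :: real assume "e > 0"
      then show "\<exists>x'\<in>complex_of_real ` {0<..}. x' \<noteq> 1 \<and> dist x' 1 < e"
        by (intro bexI[of _ "complex_of_real (1 + e / 2)"]) (auto simp: dist_norm complex_eq_iff)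
    qed
    show "F z - G z = 0" if "z \<in> complex_of_real ` {0<..}" for z
      using that by (auto simp: F_def G_def integral_gauss_real)
  qed (use a H in \<open>auto simp: H_def\<close>)
  then show ?thesis by (simp add: F_def G_def)
qed

lemma fourier_gauss:
  assumes "Re a > 0"
  shows "fourier (gauss a b) \<xi> = exp (of_real pi * (b - \<i> * of_real \<xi>)\<^sup>2 / a) / csqrt a"
proof -
  have "gauss a b x * exp (- 2 * complex_of_real pi * \<i> * of_real x * of_real \<xi>)
      = gauss a (b - \<i> * of_real \<xi>) x" for x
    unfolding gauss_def exp_add[symmetric] by (rule arg_cong[of _ _ exp]) (simp add: algebra_simps)
  then show ?thesis
    unfolding fourier_def using integral_gauss[OF assms] by simp
qed

section \<open>Chirps: Fourier transform, inversion and Schwartz bounds\<close>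

definition chirp :: "complex \<Rightarrow> real \<Rightarrow> complex" where
  "chirp w = gauss w 0"

lemma norm_chirp: "cmod (chirp w y) = exp (- pi * Re w * y\<^sup>2)"
  by (simp add: chirp_def norm_gauss)

lemma fourier_chirp:
  assumes "Re w > 0"
  shows "fourier (chirp w) \<xi> = gauss (1 / w) 0 \<xi> / csqrt w"
  unfolding chirp_def fourier_gauss[OF assms] gauss_def by (simp add: power_mult_distrib)

lemma Re_inverse_pos: "Re w > 0 \<Longrightarrow> Re (1 / w) > 0"
  by (simp add: Re_divide add_pos_nonneg)

text \<open>The principal root commutes with inversion off the nonpositive axis, so the prefactors
  of a chirp's transform and of its inverse cancel without a sign ambiguity.\<close>

lemma csqrt_inverse_mult:
  assumes "Re w > 0"
  shows "csqrt w * csqrt (1 / w) = 1"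
proof -
  have "w \<notin> \<real>\<^sub>\<le>\<^sub>0" "w \<noteq> 0" using assms by (auto simp: complex_nonpos_Reals_iff)
  then show ?thesis
    using csqrt_inverse[of w] by (simp add: inverse_eq_divide)
qed

lemma inverse_fourier_chirp:
  assumes "Re w > 0"
  shows "(LINT \<xi>|lborel. fourier (chirp w) \<xi> * exp (2 * complex_of_real pi * \<i> * of_real x * of_real \<xi>)) = chirp w x"
proof -
  have "fourier (chirp w) \<xi> * exp (2 * complex_of_real pi * \<i> * of_real x * of_real \<xi>)
     = gauss (1 / w) (\<i> * of_real x) \<xi> / csqrt w" for \<xi>
    unfolding fourier_chirp[OF assms] gauss_def by (simp add: exp_add[symmetric] algebra_simps)
  then have "(LINT \<xi>|lborel. fourier (chirp w) \<xi> * exp (2 * complex_of_real pi * \<i> * of_real x * of_real \<xi>))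
     = exp (of_real pi * (\<i> * of_real x)\<^sup>2 / (1 / w)) / csqrt (1 / w) / csqrt w"
    using integral_gauss[OF Re_inverse_pos[OF assms], of "\<i> * of_real x"] by simp
  also have "\<dots> = exp (of_real pi * (\<i> * of_real x)\<^sup>2 / (1 / w))"
    using csqrt_inverse_mult[OF assms] by (simp add: mult.commute)
  also have "\<dots> = chirp w x"
    unfolding chirp_def gauss_def by (simp add: power_mult_distrib algebra_simps)
  finally show ?thesis .
qed

text \<open>Polynomials times the chirp are stable under differentiation, which reduces the Schwartz
  seminorms to bounds on such products.\<close>

lemma vderiv_chirp:
  "\<exists>P. vderiv k (chirp w) = (\<lambda>x. poly P (of_real x) * chirp w x)"
proof (induction k)
  case 0
  show ?case by (rule exI[of _ 1]) (simp add: vderiv_def)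
next
  case (Suc k)
  then obtain P where P: "vderiv k (chirp w) = (\<lambda>x. poly P (of_real x) * chirp w x)" by blast
  let ?Q = "pderiv P + P * [:0, - 2 * of_real pi * w:]"
  have "((\<lambda>x. poly P (of_real x) * chirp w x) has_vector_derivative poly ?Q (of_real x) * chirp w x) (at x)" for x
  proof -
    have "((\<lambda>z. poly P z * exp (- of_real pi * w * z\<^sup>2)) has_field_derivative
        poly ?Q (of_real x) * chirp w x) (at (of_real x))"
      unfolding chirp_def gauss_def
      by (auto intro!: derivative_eq_intros simp: algebra_simps)
    from has_vector_derivative_real_field[OF this]
    show ?thesis by (simp add: chirp_def gauss_def)
  qed
  then have "vector_derivative (\<lambda>x. poly P (of_real x) * chirp w x) (at x) = poly ?Q (of_real x) * chirp w x" for x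
    by (rule vector_derivative_at)
  then have "vderiv (Suc k) (chirp w) = (\<lambda>x. poly ?Q (of_real x) * chirp w x)"
    using P by (simp add: vderiv_def)
  then show ?case by blast
qed

lemma exp_ge_power_fact:
  fixes x :: real
  assumes "x \<ge> 0"
  shows "x ^ m / fact m \<le> exp x"
proof -
  have "(\<Sum>n\<in>{m}. inverse (fact n) * x ^ n) \<le> exp x"
    unfolding exp_def real_scaleR_def[symmetric]
    using assms by (intro sum_le_suminf summable_exp_generic) auto
  then show ?thesis by (simp add: divide_inverse mult.commute)
qed

lemma bounded_poly_chirp:
  assumes "Re w > 0"
  shows "bounded (range (\<lambda>x. poly P (of_real x) * chirp w x))"
proof -
  have c: "pi * Re w > 0" using assms by simp
  have mono: "bounded (range (\<lambda>x. of_real x ^ m * chirp w x))" for m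
  proof -
    have "cmod (of_real x ^ m * chirp w x) \<le> fact m / (pi * Re w) ^ m + 1" for x
    proof -
      \<comment> \<open>The exponential series controls powers of \<open>x\<^sup>2\<close> only; odd
        powers are reduced to even ones here.\<close>
      have "\<bar>x\<bar> ^ m \<le> 1 + (x\<^sup>2) ^ m"
      proof (cases "\<bar>x\<bar> \<le> 1")
        case True
        then have "\<bar>x\<bar> ^ m \<le> 1" by (simp add: power_le_one)
        then show ?thesis by (smt (verit) zero_le_power zero_le_power2)
      next
        case False
        then have "\<bar>x\<bar> ^ m \<le> (\<bar>x\<bar> ^ m)\<^sup>2"
          using self_le_power[of "\<bar>x\<bar> ^ m" 2] by (simp add: one_le_power)
        also have "(\<bar>x\<bar> ^ m)\<^sup>2 = (x\<^sup>2) ^ m"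
          by (metis power_mult mult.commute power2_abs)
        finally show ?thesis by simp
      qed
      moreover have "(pi * Re w * x\<^sup>2) ^ m / fact m \<le> exp (pi * Re w * x\<^sup>2)"
        using exp_ge_power_fact[of "pi * Re w * x\<^sup>2" m] c by simp
      then have "(x\<^sup>2) ^ m * exp (- (pi * Re w * x\<^sup>2)) \<le> fact m / (pi * Re w) ^ m"
        using assms by (simp add: exp_minus field_simps)
      moreover have "exp (- (pi * Re w * x\<^sup>2)) \<le> 1" using c by simp
      moreover have "\<bar>x\<bar> ^ m * exp (- (pi * Re w * x\<^sup>2)) \<le> (1 + (x\<^sup>2) ^ m) * exp (- (pi * Re w * x\<^sup>2))"
        using calculation(1) by (rule mult_right_mono) simp
      ultimately have "\<bar>x\<bar> ^ m * exp (- (pi * Re w * x\<^sup>2)) \<le> fact m / (pi * Re w) ^ m + 1"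
        unfolding distrib_right by linarith
      then show ?thesis
        by (simp add: norm_mult norm_chirp norm_power)
    qed
    then show ?thesis by (auto simp: bounded_iff)
  qed
  have "bounded (range (\<lambda>x. \<Sum>i\<le>degree P. coeff P i * (of_real x ^ i * chirp w x)))"
  proof -
    obtain B where B: "\<And>m x. cmod (of_real x ^ m * chirp w x) \<le> B m"
      using mono unfolding bounded_iff by (metis rangeI)
    have "cmod (\<Sum>i\<le>degree P. coeff P i * (of_real x ^ i * chirp w x)) \<le> (\<Sum>i\<le>degree P. cmod (coeff P i) * B i)" for x
      by (rule order_trans[OF norm_sum]) (auto intro!: sum_mono mult_left_mono B simp: norm_mult[of "coeff P _"])
    then show ?thesis by (auto simp: bounded_iff)
  qed
  then show ?thesis by (simp add: poly_altdef sum_distrib_right mult.assoc)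
qed

lemma schwartz_chirp:
  assumes "Re w > 0"
  shows "schwartz (chirp w)"
  unfolding schwartz_def
proof (intro conjI allI)
  fix k :: nat
  obtain P where P: "vderiv k (chirp w) = (\<lambda>x. poly P (of_real x) * chirp w x)"
    using vderiv_chirp by blast
  show "vderiv k (chirp w) differentiable at x" for x
  proof -
    have "((\<lambda>z. poly P z * exp (- of_real pi * w * z\<^sup>2)) has_field_derivative
        (poly (pderiv P) (of_real x) + poly P (of_real x) * (- 2 * of_real pi * w * of_real x)) * exp (- of_real pi * w * (of_real x)\<^sup>2)) (at (of_real x))"
      by (auto intro!: derivative_eq_intros simp: algebra_simps)
    from differentiableI_vector[OF has_vector_derivative_real_field[OF this]]
    show ?thesis unfolding P by (simp add: chirp_def gauss_def)
  qed
  show "bounded (range (\<lambda>x. x ^ m *\<^sub>R vderiv k (chirp w) x))" for m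
    using bounded_poly_chirp[OF assms, of "monom 1 m * P"]
    by (simp add: P poly_monom scaleR_conv_of_real mult.assoc)
qed

section \<open>Multipliers of bounded variation and half-space integrals\<close>

lemma integrable_pair_mult:
  fixes f :: "'a \<Rightarrow> complex" and g :: "'b \<Rightarrow> complex"
  assumes "sigma_finite_measure M1" "sigma_finite_measure M2"
    and f: "integrable M1 f" and g: "integrable M2 g"
  shows "integrable (M1 \<Otimes>\<^sub>M M2) (\<lambda>(x, y). f x * g y)"
proof -
  interpret pair_sigma_finite M1 M2
    using assms by (simp add: pair_sigma_finite_def)
  have [measurable]: "f \<in> borel_measurable M1" "g \<in> borel_measurable M2"
    using f g by auto
  show ?thesis
  proof (rule Fubini_integrable)
    show "integrable M1 (\<lambda>x. LINT y|M2. cmod (case (x, y) of (x, y) \<Rightarrow> f x * g y))"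
      using f by (simp add: norm_mult)
    show "AE x in M1. integrable M2 (\<lambda>y. case (x, y) of (x, y) \<Rightarrow> f x * g y)"
      using g by simp
  qed measurable
qed

text \<open>The kernel \<open>k\<close> that couples the variables will be a cut-off indicator, a
  character, or a Gaussian times a character, all of modulus at most 1.\<close>

lemma Fubini_mult_bounded:
  fixes f :: "'a \<Rightarrow> complex" and g :: "'b \<Rightarrow> complex" and k :: "'a \<Rightarrow> 'b \<Rightarrow> complex"
  assumes M: "sigma_finite_measure M1" "sigma_finite_measure M2"
    and f: "integrable M1 f" and g: "integrable M2 g"
    and k: "case_prod k \<in> borel_measurable (M1 \<Otimes>\<^sub>M M2)"
    and B: "\<And>x y. cmod (k x y) \<le> 1"
  shows "(LINT x|M1. f x * (LINT y|M2. g y * k x y)) = (LINT y|M2. g y * (LINT x|M1. f x * k x y))"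
proof -
  interpret pair_sigma_finite M1 M2
    using M by (simp add: pair_sigma_finite_def)
  have [measurable]: "f \<in> borel_measurable M1" "g \<in> borel_measurable M2"
    using f g by auto
  note k [measurable]
  have "integrable (M1 \<Otimes>\<^sub>M M2) (\<lambda>(x, y). f x * (g y * k x y))"
  proof (rule Bochner_Integration.integrable_bound[OF integrable_pair_mult[OF M f g]])
    show "AE x in M1 \<Otimes>\<^sub>M M2. cmod (case x of (x, y) \<Rightarrow> f x * (g y * k x y)) \<le> cmod (case x of (x, y) \<Rightarrow> f x * g y)"
      using B by (intro AE_I2) (auto simp: norm_mult mult.assoc[symmetric] intro!: mult_left_le)
  qed measurable
  from Fubini_integral[OF this]
  have "(LINT y|M2. LINT x|M1. f x * (g y * k x y)) = (LINT x|M1. LINT y|M2. f x * (g y * k x y))" .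
  moreover have "(LINT x|M1. f x * (g y * k x y)) = g y * (LINT x|M1. f x * k x y)" for y
    by (simp add: mult.left_commute[of _ "g y"])
  ultimately show ?thesis by simp
qed

text \<open>A multiplier of bounded variation is a superposition of sharp cut-offs, so it is controlled
  by the supremum over all of them.\<close>
lemma bounded_variation_multiplier:
  fixes U :: "'a \<Rightarrow> complex" and X :: "'a \<Rightarrow> real" and \<phi> \<psi> :: "real \<Rightarrow> complex"
  assumes N: "sigma_finite_measure N" and U: "integrable N U"
    and X [measurable]: "X \<in> borel_measurable N"
    and \<psi>: "integrable lborel \<psi>"
    and \<phi>: "\<And>v. \<phi> v = C - (LINT m|lborel. \<psi> m * indicator {v<..} m)"
    and S: "\<And>M. cmod (LINT z:{z \<in> space N. X z < M}|N. U z) \<le> S"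
  shows "cmod (LINT z|N. U z * \<phi> (X z)) \<le> (cmod C + (LINT m|lborel. cmod (\<psi> m))) * S"
proof -
  interpret sigma_finite_measure N by (rule N)
  have [measurable]: "U \<in> borel_measurable N" "\<psi> \<in> borel_measurable borel"
    using U \<psi> by auto
  define I where "I = (\<lambda>M. LINT z|N. U z * indicator {z \<in> space N. X z < M} z)"
  have I: "cmod (I M) \<le> S" for M
    using S[of M] by (simp add: I_def set_lebesgue_integral_def scaleR_conv_of_real mult.commute
        of_real_indicator)
  \<comment> \<open>The constant \<open>C\<close> multiplies the integral without cut-off; this is
    the limit of the cut-offs at M = i, so it obeys the bound \<open>S\<close> as well.\<close>
  have lim: "(\<lambda>i. I (real i)) \<longlonglongrightarrow> (LINT z|N. U z)"
    unfolding I_def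
  proof (rule integral_dominated_convergence[where w = "\<lambda>z. cmod (U z)"])
    show "AE z in N. (\<lambda>i. U z * indicator {z \<in> space N. X z < real i} z) \<longlonglongrightarrow> U z"
    proof (rule AE_I2)
      fix z assume z: "z \<in> space N"
      obtain i0 where i0: "X z < real i0" using reals_Archimedean2 by blast
      show "(\<lambda>i. U z * indicator {z \<in> space N. X z < real i} z) \<longlonglongrightarrow> U z"
        by (rule tendsto_eventually, rule eventually_sequentiallyI[of i0])
          (use i0 z in \<open>auto simp: indicator_def\<close>)
    qed
  qed (use U in \<open>auto simp: indicator_def\<close>)
  have Iinf: "cmod (LINT z|N. U z) \<le> S"
    by (rule LIMSEQ_le_const2[OF tendsto_norm[OF lim]]) (use I in blast)
  have tail: "integrable N (\<lambda>z. U z * (LINT m|lborel. \<psi> m * indicator {X z<..} m))"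
  proof (rule Bochner_Integration.integrable_bound[where f = "\<lambda>z. (LINT m|lborel. cmod (\<psi> m)) *\<^sub>R U z"])
    show "(\<lambda>z. U z * (LINT m|lborel. \<psi> m * indicator {X z<..} m)) \<in> borel_measurable N"
      unfolding indicator_def greaterThan_iff by measurable
    show "AE z in N. cmod (U z * (LINT m|lborel. \<psi> m * indicator {X z<..} m))
        \<le> cmod ((LINT m|lborel. cmod (\<psi> m)) *\<^sub>R U z)"
    proof (rule AE_I2)
      fix z
      have "cmod (LINT m|lborel. \<psi> m * indicator {X z<..} m) \<le> (LINT m|lborel. cmod (\<psi> m))"
      proof (rule Bochner_Integration.integral_norm_bound_integral)
        show "integrable lborel (\<lambda>m. \<psi> m * indicator {X z<..} m)"
          by (rule Bochner_Integration.integrable_bound[OF \<psi>]) (auto simp: indicator_def)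
      qed (use \<psi> in \<open>auto simp: norm_mult indicator_def\<close>)
      then show "cmod (U z * (LINT m|lborel. \<psi> m * indicator {X z<..} m))
        \<le> cmod ((LINT m|lborel. cmod (\<psi> m)) *\<^sub>R U z)"
        by (simp add: norm_mult mult.commute mult_left_mono)
    qed
  qed (use U in simp)
  have "(LINT z|N. U z * \<phi> (X z)) = (LINT z|N. U z * C - U z * (LINT m|lborel. \<psi> m * indicator {X z<..} m))"
    by (simp add: \<phi> right_diff_distrib)
  also have "\<dots> = (LINT z|N. U z) * C - (LINT z|N. U z * (LINT m|lborel. \<psi> m * indicator {X z<..} m))"
    using U tail by simp
  also have "(LINT z|N. U z * (LINT m|lborel. \<psi> m * indicator {X z<..} m))
      = (LINT m|lborel. \<psi> m * (LINT z|N. U z * indicator {X z<..} m))"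
  proof (rule Fubini_mult_bounded[OF N _ U \<psi>])
    show "(\<lambda>(z, m). indicator {X z<..} m :: complex) \<in> borel_measurable (N \<Otimes>\<^sub>M lborel)"
      unfolding indicator_def greaterThan_iff by measurable
  qed (auto simp: indicator_def sigma_finite_lborel)
  \<comment> \<open>For fixed \<open>m\<close> the tail indicator says \<open>X z < m\<close>, so
    the inner integral has become the sharp cut-off at \<open>m\<close>.\<close>
  also have "(\<lambda>m. LINT z|N. U z * indicator {X z<..} m) = I"
    unfolding I_def by (intro ext Bochner_Integration.integral_cong) (auto simp: indicator_def)
  finally have eq: "(LINT z|N. U z * \<phi> (X z)) = (LINT z|N. U z) * C - (LINT m|lborel. \<psi> m * I m)" .
  have [measurable]: "I \<in> borel_measurable borel"
    unfolding I_def indicator_def mem_Collect_eq by measurable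
  have "cmod (LINT m|lborel. \<psi> m * I m) \<le> (LINT m|lborel. cmod (\<psi> m) * S)"
  proof (rule Bochner_Integration.integral_norm_bound_integral)
    have S0: "S \<ge> 0" using I[of 0] norm_ge_zero order_trans by blast
    show "integrable lborel (\<lambda>m. \<psi> m * I m)"
      by (rule Bochner_Integration.integrable_bound[where f = "\<lambda>m. S *\<^sub>R \<psi> m"])
        (use \<psi> I S0 in \<open>auto simp: norm_mult mult.commute intro!: mult_right_mono\<close>)
  qed (use \<psi> I in \<open>auto simp: norm_mult intro!: mult_left_mono\<close>)
  then have "cmod (LINT m|lborel. \<psi> m * I m) \<le> (LINT m|lborel. cmod (\<psi> m)) * S"
    by simp
  moreover have "cmod ((LINT z|N. U z) * C) \<le> cmod C * S"
    using Iinf by (simp add: norm_mult mult.commute[of _ "cmod C"] mult_left_mono)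
  ultimately show ?thesis
    unfolding eq distrib_right using norm_triangle_ineq4 by (smt (verit))
qed

text \<open>The half-space condition confines \<open>v\<close> to one side of
  \<open>- s / \<alpha>\<close>, the side depending on the sign of \<open>\<alpha>\<close>. As
  \<open>\<Psi>\<close> vanishes at both infinities, only the endpoint contributes, with that
  sign.\<close>

lemma integral_halfline_derivative:
  fixes \<Psi> u :: "real \<Rightarrow> complex"
  assumes der: "\<And>v. (\<Psi> has_vector_derivative u v) (at v)"
    and cont: "continuous_on UNIV u" and int: "integrable lborel u"
    and top: "(\<Psi> \<longlongrightarrow> 0) at_top" and bot: "(\<Psi> \<longlongrightarrow> 0) at_bot"
    and \<alpha>: "\<alpha> \<noteq> 0"
  shows "(LINT v|lborel. u v * indicator {v. 0 < s + v * \<alpha>} v) = - of_real (sgn \<alpha>) * \<Psi> (- s / \<alpha>)"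
proof -
  have isC: "isCont u v" "isCont \<Psi> v" for v
    using cont has_vector_derivative_continuous[OF der] by (auto simp: continuous_on_eq_continuous_at)
  have *: "(LINT v|lborel. u v * indicator A v) = (LINT v:A|lborel. u v)" for A
    by (simp add: set_lebesgue_integral_def scaleR_conv_of_real mult.commute of_real_indicator)
  have si: "set_integrable lborel A u" if "A \<in> sets borel" for A
    using int that unfolding set_integrable_def by (intro integrable_mult_indicator) auto
  show ?thesis
  proof (cases "\<alpha> > 0")
    case True
    then have A: "{v. 0 < s + v * \<alpha>} = {- s / \<alpha><..}"
      by (auto simp: field_simps)
    have "(LBINT v=ereal (- s / \<alpha>)..\<infinity>. u v) = 0 - \<Psi> (- s / \<alpha>)"
    proof (rule interval_integral_FTC_integrable[OF _ der isC(1)])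
      show "((\<Psi> \<circ> real_of_ereal) \<longlongrightarrow> \<Psi> (- s / \<alpha>)) (at_right (ereal (- s / \<alpha>)))"
        using isC(2)[of "- s / \<alpha>"] unfolding ereal_tendsto_simps
        by (simp add: isCont_def filterlim_at_split)
      show "((\<Psi> \<circ> real_of_ereal) \<longlongrightarrow> 0) (at_left \<infinity>)"
        using top unfolding ereal_tendsto_simps .
    qed (auto intro!: si)
    then show ?thesis
      using True unfolding * A by (simp add: interval_integral_to_infinity_eq)
  next
    case False
    then have neg: "\<alpha> < 0" using \<alpha> by simp
    then have A: "{v. 0 < s + v * \<alpha>} = {..<- s / \<alpha>}"
      by (auto simp: field_simps)
    have "(LBINT v=-\<infinity>..ereal (- s / \<alpha>). u v) = \<Psi> (- s / \<alpha>) - 0"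
    proof (rule interval_integral_FTC_integrable[OF _ der isC(1)])
      show "((\<Psi> \<circ> real_of_ereal) \<longlongrightarrow> \<Psi> (- s / \<alpha>)) (at_left (ereal (- s / \<alpha>)))"
        using isC(2)[of "- s / \<alpha>"] unfolding ereal_tendsto_simps
        by (simp add: isCont_def filterlim_at_split)
      show "((\<Psi> \<circ> real_of_ereal) \<longlongrightarrow> 0) (at_right (-\<infinity>))"
        using bot unfolding ereal_tendsto_simps .
    qed (auto intro!: si)
    moreover have "einterval (-\<infinity>) (ereal r) = {..<r}" for r
      by (auto simp: einterval_def)
    ultimately show ?thesis
      using neg unfolding * A by (simp add: interval_lebesgue_integral_def)
  qed
qed

section \<open>Reducing half-space integrals of products to one-dimensional integrals\<close>

lemma atLeastAtMost_insert_last: "n \<ge> 1 \<Longrightarrow> {1..n} = insert n {1..n - 1 :: nat}"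
  by auto

lemma borel_measurable_coordinate:
  "j \<in> {1..n} \<Longrightarrow> (\<lambda>\<xi>. \<xi> j) \<in> borel_measurable (lborel_n n)"
  using measurable_component_singleton[of j "{1..n}" "\<lambda>_. lborel"] by simp

lemma integrable_halfspace_prod:
  fixes g :: "nat \<Rightarrow> real \<Rightarrow> complex" and \<alpha> :: "nat \<Rightarrow> real"
  assumes g: "\<And>j. j \<in> {1..n} \<Longrightarrow> integrable lborel (g j)"
  shows "integrable (lborel_n n)
    (\<lambda>\<xi>. indicator {\<xi>. 0 < (\<Sum>j=1..n. \<xi> j * \<alpha> j)} \<xi> * (\<Prod>j=1..n. g j (\<xi> j)))"
proof -
  interpret product_sigma_finite "\<lambda>_::nat. lborel :: real measure" ..
  have prod: "integrable (lborel_n n) (\<lambda>\<xi>. \<Prod>j=1..n. g j (\<xi> j))"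
    by (rule product_integrable_prod) (use g in auto)
  have s: "(\<lambda>\<xi>. \<Sum>j=1..n. \<xi> j * \<alpha> j) \<in> borel_measurable (lborel_n n)"
    by (intro borel_measurable_sum borel_measurable_times borel_measurable_const borel_measurable_coordinate)
  have "(\<lambda>\<xi>. indicator {\<xi>. 0 < (\<Sum>j=1..n. \<xi> j * \<alpha> j)} \<xi> :: complex) \<in> borel_measurable (lborel_n n)"
    unfolding indicator_def mem_Collect_eq of_bool_def
    by (intro measurable_If borel_measurable_const borel_measurable_less s)
  then have "(\<lambda>\<xi>. indicator {\<xi>. 0 < (\<Sum>j=1..n. \<xi> j * \<alpha> j)} \<xi> * (\<Prod>j=1..n. g j (\<xi> j))) \<in> borel_measurable (lborel_n n)"
    using prod by (intro borel_measurable_times) auto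
  then show ?thesis
    by (rule Bochner_Integration.integrable_bound[OF prod])
      (auto simp: norm_mult indicator_def)
qed

text \<open>The multiplier depends on the last frequency alone. Integrating that frequency out first
  leaves a half-line whose endpoint sees the other frequencies only through one linear form.\<close>

lemma integral_last_coordinate:
  fixes g :: "nat \<Rightarrow> real \<Rightarrow> complex" and \<phi> :: "real \<Rightarrow> complex" and \<alpha> :: "nat \<Rightarrow> real"
  assumes n: "n \<ge> 1" and g: "\<And>j. j \<in> {1..n} \<Longrightarrow> integrable lborel (g j)"
    and \<phi> [measurable]: "\<phi> \<in> borel_measurable borel" and B: "\<And>v. cmod (\<phi> v) \<le> B"
  shows "(LINT \<xi>|lborel_n n. (indicator {\<xi>. 0 < (\<Sum>j=1..n. \<xi> j * \<alpha> j)} \<xi> * (\<Prod>j=1..n. g j (\<xi> j))) * \<phi> (\<xi> n))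
    = (LINT \<xi>|lborel_n (n - 1). (\<Prod>j=1..n - 1. g j (\<xi> j)) *
        (LINT v|lborel. (g n v * \<phi> v) * indicator {v. 0 < (\<Sum>j=1..n - 1. \<xi> j * \<alpha> j) + v * \<alpha> n} v))"
proof -
  interpret product_sigma_finite "\<lambda>_::nat. lborel :: real measure" ..
  let ?F = "\<lambda>\<xi>. (indicator {\<xi>. 0 < (\<Sum>j=1..n. \<xi> j * \<alpha> j)} \<xi> * (\<Prod>j=1..n. g j (\<xi> j))) * \<phi> (\<xi> n)"
  have int: "integrable (lborel_n n) ?F"
  proof (rule Bochner_Integration.integrable_bound)
    show "integrable (lborel_n n) (\<lambda>\<xi>. B *\<^sub>R (indicator {\<xi>. 0 < (\<Sum>j=1..n. \<xi> j * \<alpha> j)} \<xi> * (\<Prod>j=1..n. g j (\<xi> j))))"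
      by (intro integrable_scaleR_right integrable_halfspace_prod g)
    have "B \<ge> 0" using B[of 0] norm_ge_zero order_trans by blast
    then show "AE \<xi> in lborel_n n. cmod (?F \<xi>) \<le> cmod (B *\<^sub>R (indicator {\<xi>. 0 < (\<Sum>j=1..n. \<xi> j * \<alpha> j)} \<xi> * (\<Prod>j=1..n. g j (\<xi> j))))"
      by (auto simp: norm_mult mult.commute intro!: mult_right_mono B)
    have "(\<lambda>\<xi>. \<phi> (\<xi> n)) \<in> borel_measurable (lborel_n n)"
      using n by (intro measurable_compose[OF borel_measurable_coordinate \<phi>]) simp
    moreover have "(\<lambda>\<xi>. indicator {\<xi>. 0 < (\<Sum>j=1..n. \<xi> j * \<alpha> j)} \<xi> * (\<Prod>j=1..n. g j (\<xi> j))) \<in> borel_measurable (lborel_n n)"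
      by (intro borel_measurable_integrable integrable_halfspace_prod g)
    ultimately show "?F \<in> borel_measurable (lborel_n n)"
      by (rule borel_measurable_times[rotated])
  qed
  have "integral\<^sup>L (lborel_n n) ?F = (LINT \<xi>|Pi\<^sub>M (insert n {1..n - 1}) (\<lambda>_. lborel). ?F \<xi>)"
    by (simp only: atLeastAtMost_insert_last[OF n])
  also have "\<dots> = (LINT \<xi>|lborel_n (n - 1). LINT v|lborel. ?F (\<xi>(n := v)))"
  proof (rule product_integral_insert)
    show "integrable (Pi\<^sub>M (insert n {1..n - 1}) (\<lambda>_. lborel)) ?F"
      using int by (simp only: atLeastAtMost_insert_last[OF n, symmetric])
  qed (use n in auto)
  also have "(\<lambda>\<xi>. LINT v|lborel. ?F (\<xi>(n := v))) = (\<lambda>\<xi>. (\<Prod>j=1..n - 1. g j (\<xi> j)) *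
        (LINT v|lborel. (g n v * \<phi> v) * indicator {v. 0 < (\<Sum>j=1..n - 1. \<xi> j * \<alpha> j) + v * \<alpha> n} v))"
  proof
    fix \<xi> :: "nat \<Rightarrow> real"
    have nin: "n \<notin> {1..n - 1}" using n by auto
    have s: "(\<Sum>j=1..n. (\<xi>(n := v)) j * \<alpha> j) = (\<Sum>j=1..n - 1. \<xi> j * \<alpha> j) + v * \<alpha> n" for v
      unfolding atLeastAtMost_insert_last[OF n]
      by (subst sum.insert) (use nin in \<open>auto intro!: sum.cong\<close>)
    have p: "(\<Prod>j=1..n. g j ((\<xi>(n := v)) j)) = (\<Prod>j=1..n - 1. g j (\<xi> j)) * g n v" for v
      unfolding atLeastAtMost_insert_last[OF n]
      by (subst prod.insert) (use nin in \<open>auto intro!: prod.cong\<close>)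
    show "(LINT v|lborel. ?F (\<xi>(n := v))) = (\<Prod>j=1..n - 1. g j (\<xi> j)) *
        (LINT v|lborel. (g n v * \<phi> v) * indicator {v. 0 < (\<Sum>j=1..n - 1. \<xi> j * \<alpha> j) + v * \<alpha> n} v)"
      unfolding p indicator_def mem_Collect_eq s
      by (subst integral_mult_right_zero[symmetric])
        (auto intro!: Bochner_Integration.integral_cong simp: mult_ac)
  qed
  finally show ?thesis .
qed

text \<open>For each \<open>y\<close> the character of the linear form factors over the coordinates,
  so the multiple integral splits into one-dimensional Fourier integrals at the points
  \<open>y * \<beta> j\<close>. This is how the line along which the chirps are sampled
  arises.\<close>

lemma integral_prod_fourier_superposition:
  fixes h :: "nat \<Rightarrow> real \<Rightarrow> complex" and \<kappa> :: "real \<Rightarrow> complex" and \<beta> :: "nat \<Rightarrow> real"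
  assumes J: "finite J" and h: "\<And>j. j \<in> J \<Longrightarrow> integrable lborel (h j)"
    and \<kappa>: "integrable lborel \<kappa>"
  shows "(LINT \<xi>|Pi\<^sub>M J (\<lambda>_. lborel). (\<Prod>j\<in>J. h j (\<xi> j)) *
       (LINT y|lborel. \<kappa> y * exp (2 * complex_of_real pi * \<i> * of_real y * of_real (\<Sum>j\<in>J. \<xi> j * \<beta> j))))
     = (LINT y|lborel. \<kappa> y * (\<Prod>j\<in>J. LINT \<xi>|lborel. h j \<xi> * exp (2 * complex_of_real pi * \<i> * of_real (y * \<beta> j) * of_real \<xi>)))"
proof -
  interpret product_sigma_finite "\<lambda>_::nat. lborel :: real measure" ..
  have [measurable]: "h j \<in> borel_measurable borel" if "j \<in> J" for j
    using h[OF that] by auto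
  let ?e = "\<lambda>y \<xi>. exp (2 * complex_of_real pi * \<i> * of_real y * of_real (\<Sum>j\<in>J. \<xi> j * \<beta> j))"
  have "(LINT \<xi>|Pi\<^sub>M J (\<lambda>_. lborel). (\<Prod>j\<in>J. h j (\<xi> j)) * (LINT y|lborel. \<kappa> y * ?e y \<xi>))
     = (LINT y|lborel. \<kappa> y * (LINT \<xi>|Pi\<^sub>M J (\<lambda>_. lborel). (\<Prod>j\<in>J. h j (\<xi> j)) * ?e y \<xi>))"
  proof (rule Fubini_mult_bounded[OF _ _ _ \<kappa>])
    show "sigma_finite_measure (Pi\<^sub>M J (\<lambda>_. lborel :: real measure))"
      by (rule sigma_finite[OF J])
    show "integrable (Pi\<^sub>M J (\<lambda>_. lborel)) (\<lambda>\<xi>. \<Prod>j\<in>J. h j (\<xi> j))"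
      by (rule product_integrable_prod[OF J h])
    show "(\<lambda>(\<xi>, y). ?e y \<xi>) \<in> borel_measurable (Pi\<^sub>M J (\<lambda>_. lborel) \<Otimes>\<^sub>M lborel)"
      using J by measurable
    show "cmod (?e y \<xi>) \<le> 1" for \<xi> y by simp
  qed (simp add: sigma_finite_lborel)
  also have "(\<lambda>y. LINT \<xi>|Pi\<^sub>M J (\<lambda>_. lborel). (\<Prod>j\<in>J. h j (\<xi> j)) * ?e y \<xi>)
     = (\<lambda>y. \<Prod>j\<in>J. LINT \<xi>|lborel. h j \<xi> * exp (2 * complex_of_real pi * \<i> * of_real (y * \<beta> j) * of_real \<xi>))"
  proof
    fix y :: real
    have "(\<Prod>j\<in>J. h j (\<xi> j)) * ?e y \<xi>
        = (\<Prod>j\<in>J. h j (\<xi> j) * exp (2 * complex_of_real pi * \<i> * of_real (y * \<beta> j) * of_real (\<xi> j)))" for \<xi>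
      unfolding prod.distrib exp_sum[OF J, symmetric]
      by (simp add: sum_distrib_left mult_ac)
    then show "(LINT \<xi>|Pi\<^sub>M J (\<lambda>_. lborel). (\<Prod>j\<in>J. h j (\<xi> j)) * ?e y \<xi>)
     = (\<Prod>j\<in>J. LINT \<xi>|lborel. h j \<xi> * exp (2 * complex_of_real pi * \<i> * of_real (y * \<beta> j) * of_real \<xi>))"
      using product_integral_prod[OF J, of "\<lambda>j \<xi>. h j \<xi> * exp (2 * complex_of_real pi * \<i> * of_real (y * \<beta> j) * of_real \<xi>)"]
      by (simp add: Bochner_Integration.integrable_bound[OF h] norm_mult)
  qed
  finally show ?thesis .
qed

section \<open>The Gaussian step applied to a chirp\<close>

lemma gauss_primitive_exists:
  "\<exists>E :: complex \<Rightarrow> complex. E 0 = 0 \<and> (\<forall>z. (E has_field_derivative exp (- (of_real pi * z\<^sup>2))) (at z))"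
proof -
  have hol: "(\<lambda>z::complex. exp (- (of_real pi * z\<^sup>2))) holomorphic_on UNIV"
    by (intro holomorphic_intros)
  have "\<exists>E :: complex \<Rightarrow> complex. \<forall>z. (E has_field_derivative exp (- (of_real pi * z\<^sup>2))) (at z)"
    by (rule holomorphic_convex_primitive'[OF convex_UNIV open_UNIV hol]) auto
  then obtain E :: "complex \<Rightarrow> complex" where "\<And>z. (E has_field_derivative exp (- (of_real pi * z\<^sup>2))) (at z)"
    by blast
  then show ?thesis
    by (intro exI[of _ "\<lambda>z. E z - E 0"]) (auto intro!: derivative_eq_intros)
qed

text \<open>In classical notation this is erf(sqrt(pi) z) / 2; on the real line it is a smooth step
  from -1/2 to 1/2. The derivative and the value at 0 determine it uniquely.\<close>

definition gauss_primitive :: "complex \<Rightarrow> complex" where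
  "gauss_primitive = (SOME E. E 0 = 0 \<and> (\<forall>z. (E has_field_derivative exp (- (of_real pi * z\<^sup>2))) (at z)))"

lemma gauss_primitive_0 [simp]: "gauss_primitive 0 = 0"
  and has_field_derivative_gauss_primitive:
    "(gauss_primitive has_field_derivative exp (- (of_real pi * z\<^sup>2))) (at z)"
  using someI_ex[OF gauss_primitive_exists] by (auto simp: gauss_primitive_def)

lemma norm_gauss_primitive_le:
  assumes "cmod z \<le> 1"
  shows "cmod (gauss_primitive z) \<le> exp pi"
proof -
  have "cmod (gauss_primitive z - gauss_primitive 0) \<le> exp pi * cmod (z - 0)"
  proof (rule field_differentiable_bound[where S = "cball 0 1"])
    fix y :: complex assume y: "y \<in> cball 0 1"
    show "(gauss_primitive has_field_derivative exp (- (of_real pi * y\<^sup>2))) (at y within cball 0 1)"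
      by (rule has_field_derivative_at_within[OF has_field_derivative_gauss_primitive])
    have "cmod (exp (- (of_real pi * y\<^sup>2))) \<le> exp (cmod (- (of_real pi * y\<^sup>2)))"
      by (rule norm_exp)
    also have "\<dots> \<le> exp pi"
      using y by (simp add: norm_mult norm_power power_le_one)
    finally show "cmod (exp (- (of_real pi * y\<^sup>2))) \<le> exp pi" .
  qed (use assms in auto)
  also have "\<dots> \<le> exp pi"
    using assms by (simp add: mult_left_le)
  finally show ?thesis by simp
qed

section \<open>Parameters of the cut-off for a fixed chirp rate and a fixed point\<close>

locale chirp_cutoff =
  fixes L x :: real
  assumes L: "L \<ge> 4" and x: "0 \<le> x" "x \<le> 1"
begin

definition w :: complex where "w = Complex 1 (- L)"
text \<open>Up to sign, the linear coefficient of the Gaussian \<open>chirp w (x + y)\<close> times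
  the character of frequency \<open>- v\<close> in \<open>y\<close>. Its imaginary part measures the
  distance of \<open>v\<close> from \<open>L * x\<close>, the local frequency of the chirp at
  \<open>x\<close>.\<close>

definition \<zeta> :: "real \<Rightarrow> complex" where "\<zeta> v = Complex x (v - L * x)"
text \<open>The width after multiplying the chirp by the real Gaussian
  \<open>exp (- pi * t\<^sup>2 * L * y\<^sup>2)\<close>; averaging such Gaussians over
  \<open>t\<close> in [0, 1] will build the step.\<close>

definition a :: "real \<Rightarrow> complex" where "a t = w + of_real (t\<^sup>2 * L)"
definition r :: "real \<Rightarrow> complex" where "r t = csqrt (a t)"
text \<open>A square root of \<open>1 / w - 1 / a t\<close> that vanishes at \<open>t = 0\<close>:
  it measures how the transformed Gaussian of width \<open>a t\<close> differs from that of width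
  \<open>w\<close>.\<close>

definition \<theta> :: "real \<Rightarrow> complex" where "\<theta> t = of_real (sqrt L * t) / (csqrt w * r t)"

lemma L0: "L > 0" "L \<noteq> 0" using L by auto

lemma \<zeta>_eq: "\<zeta> v = w * of_real x + \<i> * of_real v"
  by (simp add: \<zeta>_def w_def complex_eq_iff)

lemma a_eq: "a t = Complex (1 + t\<^sup>2 * L) (- L)"
  by (simp add: a_def w_def complex_eq_iff)

lemma Re_a: "Re (a t) \<ge> 1"
  using L0 by (simp add: a_eq)

lemma Re_w: "Re w = 1" by (simp add: w_def)

lemma w_nz: "w \<noteq> 0" "csqrt w \<noteq> 0" using Re_w by auto

lemma a_nz: "a t \<noteq> 0" using Re_a[of t] by auto

lemma r_nz: "r t \<noteq> 0" using a_nz by (simp add: r_def)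

lemma r2: "(r t)\<^sup>2 = a t" by (simp add: r_def)

lemma norm_a: "cmod (a t) \<ge> 1"
  using Re_a[of t] complex_Re_le_cmod[of "a t"] by linarith

lemma norm_r: "cmod (r t) \<ge> 1"
proof -
  have "(cmod (r t))\<^sup>2 = cmod (a t)" by (metis norm_power r2)
  then show ?thesis using norm_a[of t]
    by (metis abs_norm_cancel one_power2 power2_le_iff_abs_le zero_le_one le_numeral_extra(4) linorder_linear power2_le_imp_le norm_ge_zero)
qed

lemma has_vector_derivative_r: "(r has_vector_derivative of_real (t * L) / r t) (at t)"
proof -
  have "a t \<notin> \<real>\<^sub>\<le>\<^sub>0" using Re_a[of t] by (auto simp: complex_nonpos_Reals_iff)
  then have 1: "(csqrt has_field_derivative inverse (2 * csqrt (a t))) (at (a t))"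
    by (rule has_field_derivative_csqrt)
  have 2: "(a has_vector_derivative of_real (2 * t * L)) (at t)"
  proof -
    have "((\<lambda>t. t\<^sup>2 * L) has_real_derivative 2 * t * L) (at t)"
      by (auto intro!: derivative_eq_intros)
    from has_vector_derivative_add[OF has_vector_derivative_const[of w] has_vector_derivative_of_real[OF this]]
    show ?thesis unfolding a_def by simp
  qed
  from field_vector_diff_chain_at[OF 2 1]
  show ?thesis
    unfolding r_def comp_def by (simp add: field_simps)
qed

lemma continuous_on_r: "continuous_on A r"
  by (metis has_vector_derivative_r continuous_at_imp_continuous_on has_vector_derivative_continuous)

lemma has_vector_derivative_\<theta>:
  "(\<theta> has_vector_derivative of_real (sqrt L) * csqrt w / (r t)^3) (at t)"
proof -
  have "((\<lambda>t. inverse (r t)) has_vector_derivative (of_real (t * L) / r t) * - (inverse (r t) ^ Suc (Suc 0))) (at t)"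
    using field_vector_diff_chain_at[OF has_vector_derivative_r DERIV_inverse[OF r_nz]]
    by (simp add: comp_def)
  moreover have "((\<lambda>t. complex_of_real (sqrt L * t)) has_vector_derivative of_real (sqrt L)) (at t)"
    by (rule has_vector_derivative_of_real) (auto intro!: derivative_eq_intros)
  ultimately have "((\<lambda>t. inverse (csqrt w) * (of_real (sqrt L * t) * inverse (r t))) has_vector_derivative
     inverse (csqrt w) * (of_real (sqrt L * t) * ((of_real (t * L) / r t) * - (inverse (r t) ^ Suc (Suc 0)))
       + of_real (sqrt L) * inverse (r t))) (at t)"
    by (intro has_vector_derivative_mult_right has_vector_derivative_mult)
  moreover have "inverse (csqrt w) * (of_real (sqrt L * t) * ((of_real (t * L) / r t) * - (inverse (r t) ^ Suc (Suc 0)))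
       + of_real (sqrt L) * inverse (r t)) = of_real (sqrt L) * csqrt w / (r t)^3"
  proof -
    have "inverse (csqrt w) * (of_real (sqrt L * t) * ((of_real (t * L) / r t) * - (inverse (r t) ^ Suc (Suc 0)))
       + of_real (sqrt L) * inverse (r t)) = of_real (sqrt L) * ((r t)\<^sup>2 - of_real (t\<^sup>2 * L)) / (csqrt w * (r t)^3)"
      using r_nz[of t] w_nz by (simp add: field_simps power2_eq_square power3_eq_cube)
    \<comment> \<open>The numerator no longer depends on \<open>t\<close>, which is why the
      derivative of \<theta> is a pure power of \<open>r t\<close>.\<close>
    also have "(r t)\<^sup>2 - of_real (t\<^sup>2 * L) = csqrt w * csqrt w"
      by (simp add: r2 a_def flip: power2_eq_square)
    finally show ?thesis using w_nz by simp
  qed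
  moreover have "(\<lambda>t. inverse (csqrt w) * (of_real (sqrt L * t) * inverse (r t))) = \<theta>"
    by (simp add: \<theta>_def fun_eq_iff divide_inverse mult_ac)
  ultimately show ?thesis by simp
qed

lemma \<theta>2: "(\<theta> t)\<^sup>2 = of_real (t\<^sup>2 * L) / (w * a t)"
  using L0 by (simp add: \<theta>_def power_divide power_mult_distrib r2 flip: of_real_power)

section \<open>The multiplier \<phi>, its derivative \<psi> and its total variation\<close>

definition \<phi> :: "real \<Rightarrow> complex" where "\<phi> v = gauss_primitive (\<theta> 1 * \<zeta> v)"
definition \<psi> :: "real \<Rightarrow> complex" where "\<psi> v = \<i> * \<theta> 1 * exp (- (of_real pi * (\<theta> 1 * \<zeta> v)\<^sup>2))"

lemma has_vector_derivative_\<zeta>: "(\<zeta> has_vector_derivative \<i>) (at v within S)"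
  unfolding \<zeta>_eq[abs_def] by (auto intro!: derivative_eq_intros)

lemma continuous_on_\<zeta>: "continuous_on A \<zeta>"
  unfolding \<zeta>_eq[abs_def] by (intro continuous_intros)

lemma has_vector_derivative_\<phi>: "(\<phi> has_vector_derivative \<psi> v) (at v)"
proof -
  have "((\<lambda>v. \<theta> 1 * \<zeta> v) has_vector_derivative \<theta> 1 * \<i>) (at v)"
    by (intro has_vector_derivative_mult_right has_vector_derivative_\<zeta>)
  from field_vector_diff_chain_at[OF this has_field_derivative_gauss_primitive]
  show ?thesis unfolding \<phi>_def[abs_def] comp_def \<psi>_def by (simp add: mult_ac)
qed

text \<open>The negative real part of \<open>\<theta>(1)\<^sup>2\<close> makes \<open>\<psi>\<close> a Gaussian of width \<open>L\<^bsup>1/2\<^esup>\<close>,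
  against a prefactor of size \<open>L\<^bsup>-1/2\<^esup>\<close>.\<close>
lemma \<theta>1_bounds:
  shows "Re ((\<theta> 1)\<^sup>2) \<le> - 1 / (7 * L)" "Re ((\<theta> 1)\<^sup>2) \<ge> - 1 / (2 * L)"
    and "\<bar>Im ((\<theta> 1)\<^sup>2)\<bar> \<le> 1 / L" "cmod (\<theta> 1) \<le> sqrt (2 / L)"
proof -
  \<comment> \<open>These are minus the real and imaginary parts of \<open>w * a 1\<close>, by which
    \<open>L\<close> is divided in \<open>(\<theta> 1)\<^sup>2\<close>. For L \<ge> 4 both are
    comparable to \<open>L\<^sup>2\<close>, so \<open>(\<theta> 1)\<^sup>2\<close> has size
    1/L.\<close>
  define p q where "p = L\<^sup>2 - L - 1" and "q = L\<^sup>2 + 2 * L"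
  have wa: "w * a 1 = Complex (- p) (- q)"
    by (simp add: w_def a_eq complex_eq_iff p_def q_def power2_eq_square algebra_simps)
  define D where "D = p\<^sup>2 + q\<^sup>2"
  have th: "(\<theta> 1)\<^sup>2 = of_real L / Complex (- p) (- q)"
    using \<theta>2[of 1] wa by simp
  have Re: "Re ((\<theta> 1)\<^sup>2) = - L * p / D" and Im: "Im ((\<theta> 1)\<^sup>2) = L * q / D"
    unfolding th by (simp_all add: Re_divide Im_divide D_def)
  have L2: "4 * L \<le> L\<^sup>2" using L by (simp add: power2_eq_square)
  have p1: "L\<^sup>2 / 2 \<le> p" using L L2 by (simp add: p_def)
  have p2: "p \<le> L\<^sup>2" using L by (simp add: p_def)
  have q1: "L\<^sup>2 \<le> q" using L by (simp add: q_def)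
  have q2: "q \<le> 3 / 2 * L\<^sup>2" using L2 by (simp add: q_def)
  have "L\<^sup>2 > 0" using L0 by simp
  with p1 q1 have p0: "p > 0" and q0: "q > 0" by linarith+
  have D1: "D \<le> 13 / 4 * (L\<^sup>2)\<^sup>2"
  proof -
    have "p\<^sup>2 \<le> (L\<^sup>2)\<^sup>2"
      by (rule power_mono[OF p2]) (use p0 in simp)
    moreover have "q\<^sup>2 \<le> (3 / 2 * L\<^sup>2)\<^sup>2"
      by (rule power_mono[OF q2]) (use q0 in simp)
    ultimately show ?thesis by (simp add: D_def power_mult_distrib power_divide)
  qed
  have D0: "D > 0" using p0 by (simp add: D_def add_pos_nonneg)
  have "D \<le> 7 * (L\<^sup>2 * p)"
  proof -
    have "L\<^sup>2 * (L\<^sup>2 / 2) \<le> L\<^sup>2 * p" by (rule mult_left_mono[OF p1]) simp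
    then have "(L\<^sup>2)\<^sup>2 / 2 \<le> L\<^sup>2 * p" by (simp only: power2_eq_square[of "L\<^sup>2"] times_divide_eq_right)
    then show ?thesis using D1 zero_le_power2[of "L\<^sup>2"] by linarith
  qed
  then show 1: "Re ((\<theta> 1)\<^sup>2) \<le> - 1 / (7 * L)"
    unfolding Re using D0 L0 by (simp add: field_simps power2_eq_square)
  have "(L\<^sup>2)\<^sup>2 \<le> q\<^sup>2"
    by (rule power_mono[OF q1]) simp
  \<comment> \<open>The arithmetic-geometric mean inequality for \<open>p\<close> and
    \<open>L\<^sup>2\<close>, with \<open>q\<close> bounded below by
    \<open>L\<^sup>2\<close>.\<close>
  then have "2 * (L\<^sup>2 * p) \<le> D"
    using zero_le_power2[of "p - L\<^sup>2"] by (simp add: D_def power2_diff mult_ac)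
  then show 2: "Re ((\<theta> 1)\<^sup>2) \<ge> - 1 / (2 * L)"
    unfolding Re using D0 L0 by (simp add: field_simps power2_eq_square)
  have "L\<^sup>2 * q \<le> D"
    using mult_right_mono[OF q1, of q] q0 by (simp add: D_def power2_eq_square add_increasing)
  then show 3: "\<bar>Im ((\<theta> 1)\<^sup>2)\<bar> \<le> 1 / L"
    unfolding Im using D0 L0 q0 by (simp add: field_simps power2_eq_square)
  have "(cmod (\<theta> 1))\<^sup>2 = cmod ((\<theta> 1)\<^sup>2)" by (simp add: norm_power)
  also have "\<dots> \<le> \<bar>Re ((\<theta> 1)\<^sup>2)\<bar> + \<bar>Im ((\<theta> 1)\<^sup>2)\<bar>"
    by (rule cmod_le)
  also have "\<dots> \<le> 1 / (2 * L) + 1 / L"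
  proof (rule add_mono[OF _ 3])
    have "- 1 / (7 * L) \<le> 0" using L0 by simp
    then show "\<bar>Re ((\<theta> 1)\<^sup>2)\<bar> \<le> 1 / (2 * L)"
      using 1 2 by linarith
  qed
  also have "\<dots> \<le> 2 / L" using L0 by (simp add: field_simps)
  finally show "cmod (\<theta> 1) \<le> sqrt (2 / L)" by (rule real_le_rsqrt)
qed

text \<open>With u = v - L x, the real part of \<open>(\<zeta> v)\<^sup>2\<close> is
  \<open>x\<^sup>2 - u\<^sup>2\<close>, so the negative real part of
  \<open>(\<theta> 1)\<^sup>2\<close> yields decay at rate 1/(7 L) in \<open>u\<^sup>2\<close>. Half
  of it pays for the cross term; what remains of the errors is 1/2 + 7/2 = 4.\<close>

lemma norm_\<psi>_le: "cmod (\<psi> v) \<le> sqrt (2 / L) * exp (4 * pi) * exp (- (pi / (14 * L)) * (v - L * x)\<^sup>2)"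
proof -
  define u where "u = v - L * x"
  have z: "(\<zeta> v)\<^sup>2 = Complex (x\<^sup>2 - u\<^sup>2) (2 * x * u)"
    by (simp add: \<zeta>_def u_def complex_eq_iff power2_eq_square)
  have "Re (T * Complex A B) = Re T * A - Im T * B" for T A B by simp
  then have "Re ((\<theta> 1 * \<zeta> v)\<^sup>2) = Re ((\<theta> 1)\<^sup>2) * (x\<^sup>2 - u\<^sup>2) - Im ((\<theta> 1)\<^sup>2) * (2 * x * u)"
    unfolding power_mult_distrib z by blast
  moreover have "Re ((\<theta> 1)\<^sup>2) * x\<^sup>2 \<ge> - 1 / 2"
  proof -
    have "x\<^sup>2 \<le> 1" using x by (simp add: power_le_one)
    moreover have "Re ((\<theta> 1)\<^sup>2) \<ge> - 1 / 2"
      by (rule order_trans[OF _ \<theta>1_bounds(2)]) (use L in \<open>simp add: field_simps\<close>)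
    moreover have "- 1 / (7 * L) \<le> 0" using L0 by simp
    ultimately have "(- Re ((\<theta> 1)\<^sup>2)) * x\<^sup>2 \<le> 1 / 2 * 1"
      using \<theta>1_bounds(1) by (intro mult_mono) (linarith | simp)+
    then show ?thesis by simp
  qed
  moreover have "- Re ((\<theta> 1)\<^sup>2) * u\<^sup>2 \<ge> 1 / (7 * L) * u\<^sup>2"
    using \<theta>1_bounds(1) by (intro mult_right_mono) auto
  moreover have "\<bar>Im ((\<theta> 1)\<^sup>2) * (2 * x * u)\<bar> \<le> u\<^sup>2 / (14 * L) + 7 / 2"
  proof -
    have "\<bar>Im ((\<theta> 1)\<^sup>2) * (2 * x * u)\<bar> \<le> 1 / L * (2 * 1 * \<bar>u\<bar>)"
      unfolding abs_mult using x L0 by (intro mult_mono \<theta>1_bounds(3)) auto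
    \<comment> \<open>The weight 14 makes the quadratic term exactly half of the available decay
      after division by \<open>L\<close>; the constant 14/L is at most 7/2 because L \<ge>
      4.\<close>
    moreover have "2 * \<bar>u\<bar> \<le> u\<^sup>2 / 14 + 14"
      using zero_le_power2[of "\<bar>u\<bar> - 14"] by (simp add: power2_eq_square algebra_simps)
    then have "2 * \<bar>u\<bar> / L \<le> (u\<^sup>2 / 14 + 14) / L"
      using L0 by (intro divide_right_mono) auto
    moreover have "(u\<^sup>2 / 14 + 14) / L \<le> u\<^sup>2 / (14 * L) + 7 / 2"
      using L by (simp add: field_simps)
    ultimately show ?thesis by simp
  qed
  moreover have "1 / (7 * L) * u\<^sup>2 = 2 * (u\<^sup>2 / (14 * L))"
    by simp
  ultimately have "Re ((\<theta> 1 * \<zeta> v)\<^sup>2) \<ge> u\<^sup>2 / (14 * L) - 4"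
    unfolding right_diff_distrib abs_le_iff by linarith
  then have "pi * (u\<^sup>2 / (14 * L) - 4) \<le> pi * Re ((\<theta> 1 * \<zeta> v)\<^sup>2)"
    by (rule mult_left_mono) simp
  then have "cmod (exp (- (of_real pi * (\<theta> 1 * \<zeta> v)\<^sup>2))) \<le> exp (4 * pi + (- (pi / (14 * L)) * u\<^sup>2))"
    unfolding norm_exp_eq_Re by (simp add: algebra_simps)
  then show ?thesis
    unfolding \<psi>_def norm_mult norm_ii u_def exp_add mult.assoc mult_1_left
    using L0 by (intro mult_mono \<theta>1_bounds(4)) auto
qed

lemma gaussian_tail_eq:
  "exp (- (pi / (14 * L)) * (v - L * x)\<^sup>2) = exp (- pi * L * x\<^sup>2 / 14) * exp (- (pi / (14 * L)) * v\<^sup>2 + (pi * x / 7) * v)"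
  unfolding exp_add[symmetric] using L0
  by (intro arg_cong[of _ _ exp]) (simp add: field_simps power2_eq_square)

lemma integrable_tail: "integrable lborel (\<lambda>v. exp (- (pi / (14 * L)) * (v - L * x)\<^sup>2))"
  unfolding gaussian_tail_eq using L0 by (intro integrable_mult_right integrable_real_gaussian) simp

lemma continuous_on_\<psi>: "continuous_on A \<psi>"
  unfolding \<psi>_def by (intro continuous_intros continuous_on_\<zeta>)

lemma integrable_\<psi>: "integrable lborel \<psi>"
proof (rule Bochner_Integration.integrable_bound)
  show "integrable lborel (\<lambda>v. sqrt (2 / L) * exp (4 * pi) * exp (- (pi / (14 * L)) * (v - L * x)\<^sup>2))"
    by (intro integrable_mult_right integrable_tail)
  show "\<psi> \<in> borel_measurable lborel"
    using borel_measurable_continuous_onI[OF continuous_on_\<psi>] by simp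
  have "sqrt (2 / L) * exp (4 * pi) \<ge> 0" using L0 by simp
  then show "AE v in lborel. cmod (\<psi> v) \<le> norm (sqrt (2 / L) * exp (4 * pi) * exp (- (pi / (14 * L)) * (v - L * x)\<^sup>2))"
    using norm_\<psi>_le L0 by auto
qed

text \<open>The Gaussian has integral \<open>sqrt (14 * L)\<close> and the prefactor is
  \<open>sqrt (2 / L)\<close>, so \<open>L\<close> cancels and the variation of \<phi> is bounded
  independently of \<open>L\<close> and \<open>x\<close>.\<close>

lemma integral_norm_\<psi>: "(LINT v|lborel. cmod (\<psi> v)) \<le> sqrt 28 * exp (4 * pi)"
proof -
  have "(LINT v|lborel. cmod (\<psi> v)) \<le> (LINT v|lborel. sqrt (2 / L) * exp (4 * pi) * exp (- (pi / (14 * L)) * (v - L * x)\<^sup>2))"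
    using integrable_\<psi> integrable_tail norm_\<psi>_le by (intro integral_mono) auto
  also have "\<dots> = sqrt (2 / L) * exp (4 * pi) * (LINT v|lborel. exp (- (pi / (14 * L)) * (v - L * x)\<^sup>2))"
    by (rule integral_mult_right_zero)
  also have "(LINT v|lborel. exp (- (pi / (14 * L)) * (v - L * x)\<^sup>2)) = (LINT v|lborel. exp (- (pi / (14 * L)) * v\<^sup>2))"
    using lborel_integral_real_affine[of 1 "\<lambda>v. exp (- (pi / (14 * L)) * (v - L * x)\<^sup>2)" "L * x"] by simp
  also have "\<dots> = sqrt (14 * L)"
  proof -
    have "complex_of_real (LINT v|lborel. exp (- (pi / (14 * L)) * v\<^sup>2)) = (LINT v|lborel. gauss (of_real (1 / (14 * L))) 0 v)"
      unfolding integral_complex_of_real[symmetric] gauss_def exp_of_real[symmetric]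
      by (intro Bochner_Integration.integral_cong) auto
    also have "\<dots> = of_real (1 / sqrt (1 / (14 * L)))"
      using L0 by (subst integral_gauss_real) auto
    finally show ?thesis
      using L0 by (simp add: real_sqrt_divide del: of_real_divide)
  qed
  also have "sqrt (2 / L) * exp (4 * pi) * sqrt (14 * L) = sqrt (2 / L * (14 * L)) * exp (4 * pi)"
    unfolding real_sqrt_mult[of "2 / L" "14 * L"] by simp
  also have "2 / L * (14 * L) = 28" using L0 by simp
  finally show ?thesis .
qed

text \<open>The limit of \<phi> at plus infinity. It is anchored at \<open>v = L * x\<close>, where
  \<zeta> is real and small, so no asymptotics of the error function along a complex line
  enter.\<close>

definition C :: complex where
  "C = \<phi> (L * x) + (LINT m|lborel. \<psi> m * indicator {L * x<..} m)"

lemma integrable_\<psi>_indicator: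
  assumes "A \<in> sets borel"
  shows "integrable lborel (\<lambda>m. \<psi> m * indicator A m)"
  by (rule Bochner_Integration.integrable_bound[OF integrable_\<psi>])
    (use assms borel_measurable_continuous_onI[OF continuous_on_\<psi>] in \<open>auto simp: indicator_def\<close>)

lemma \<phi>_tail_difference:
  assumes "u \<le> v"
  shows "\<phi> v - \<phi> u = (LINT m|lborel. \<psi> m * indicator {u<..} m) - (LINT m|lborel. \<psi> m * indicator {v<..} m)"
proof -
  have "has_bochner_integral lborel (\<lambda>m. indicator {u..v} m *\<^sub>R \<psi> m) (\<phi> v - \<phi> u)"
    by (rule has_bochner_integral_FTC_Icc[OF assms])
      (auto intro: has_vector_derivative_at_within has_vector_derivative_\<phi> continuous_on_\<psi>)
  then have "\<phi> v - \<phi> u = (LINT m|lborel. indicator {u..v} m *\<^sub>R \<psi> m)"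
    by (simp add: has_bochner_integral_integral_eq)
  also have "\<dots> = (LINT m|lborel. \<psi> m * indicator {u<..} m - \<psi> m * indicator {v<..} m)"
  proof (rule integral_cong_AE)
    show "AE m in lborel. indicator {u..v} m *\<^sub>R \<psi> m = \<psi> m * indicator {u<..} m - \<psi> m * indicator {v<..} m"
      \<comment> \<open>The closed interval and the difference of the two open tails disagree only
        at the point \<open>u\<close>.\<close>
      using AE_lborel_singleton[of u] by eventually_elim (use assms in \<open>auto simp: indicator_def\<close>)
  qed (use borel_measurable_continuous_onI[OF continuous_on_\<psi>] in auto)
  also have "\<dots> = (LINT m|lborel. \<psi> m * indicator {u<..} m) - (LINT m|lborel. \<psi> m * indicator {v<..} m)"
    by (intro Bochner_Integration.integral_diff integrable_\<psi>_indicator) auto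
  finally show ?thesis .
qed

lemma \<phi>_eq: "\<phi> v = C - (LINT m|lborel. \<psi> m * indicator {v<..} m)"
  using \<phi>_tail_difference[of v "L * x"] \<phi>_tail_difference[of "L * x" v]
  by (cases "v \<le> L * x") (auto simp: C_def algebra_simps)

lemma norm_tail_le:
  "cmod (LINT m|lborel. \<psi> m * indicator {v<..} m) \<le> sqrt 28 * exp (4 * pi)"
proof -
  have "cmod (LINT m|lborel. \<psi> m * indicator {v<..} m) \<le> (LINT m|lborel. cmod (\<psi> m))"
    by (rule Bochner_Integration.integral_norm_bound_integral)
      (use integrable_\<psi> integrable_\<psi>_indicator[of "{v<..}"] in \<open>auto simp: norm_mult indicator_def\<close>)
  then show ?thesis using integral_norm_\<psi> by linarith
qed

text \<open>At the anchor \<zeta> equals \<open>x\<close>, and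
  \<open>cmod (\<theta> 1) \<le> sqrt (2 / L)\<close> keeps the argument in the unit disc, where the
  error function is bounded by exp pi.\<close>

lemma norm_C_le: "cmod C \<le> exp pi + sqrt 28 * exp (4 * pi)"
proof -
  have "cmod (\<theta> 1 * \<zeta> (L * x)) = cmod (\<theta> 1) * x"
    using x by (simp add: norm_mult \<zeta>_def complex_norm)
  also have "\<dots> \<le> sqrt (2 / L) * 1"
    using \<theta>1_bounds(4) x L0 by (intro mult_mono) auto
  also have "sqrt (2 / L) \<le> sqrt 1"
    using L by (intro real_sqrt_le_mono) auto
  finally have "cmod (\<phi> (L * x)) \<le> exp pi"
    unfolding \<phi>_def by (intro norm_gauss_primitive_le) simp
  then show ?thesis
    unfolding C_def using norm_tail_le[of "L * x"] norm_triangle_le by (smt (verit))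
qed

lemma norm_\<phi>_le: "cmod (\<phi> v) \<le> exp pi + 2 * (sqrt 28 * exp (4 * pi))"
  using norm_C_le norm_tail_le[of v] norm_triangle_ineq4[of C "LINT m|lborel. \<psi> m * indicator {v<..} m"]
  unfolding \<phi>_eq by linarith

lemma continuous_on_\<phi>: "continuous_on A \<phi>"
  by (metis has_vector_derivative_\<phi> continuous_at_imp_continuous_on has_vector_derivative_continuous)

section \<open>An explicit antiderivative of the product of \<phi> and the transformed chirp\<close>

definition A0 :: complex where "A0 = exp (- (of_real pi * w * (of_real x)\<^sup>2))"
text \<open>The Fourier transform in \<open>y\<close> of \<open>chirp w (x + y)\<close> times the
  Gaussian with parameter \<open>t\<close>, as \<open>integral_kern\<close> confirms;
  \<open>kd\<close> is its derivative in \<open>v\<close>.\<close>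

definition k :: "real \<Rightarrow> real \<Rightarrow> complex" where
  "k t v = A0 / r t * exp (of_real pi * (\<zeta> v)\<^sup>2 / a t)"
definition kd :: "real \<Rightarrow> real \<Rightarrow> complex" where
  "kd t v = A0 * (2 * of_real pi * \<i> * \<zeta> v) / (r t) ^ 3 * exp (of_real pi * (\<zeta> v)\<^sup>2 / a t)"
definition g :: "real \<Rightarrow> complex" where
  "g v = A0 / csqrt w * exp (of_real pi * (\<zeta> v)\<^sup>2 / w)"
text \<open>Integrating in frequency amounts to dividing by \<open>y\<close> in space. The average
  over \<open>t\<close> performs this division on the Gaussian step without creating a singularity
  at \<open>y = 0\<close>.\<close>

definition \<Psi> :: "real \<Rightarrow> complex" where
  "\<Psi> v = of_real (sqrt L) / (2 * of_real pi * \<i>) * integral (cbox 0 1) (\<lambda>t. k t v)"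

lemma has_vector_derivative_k: "(k t has_vector_derivative kd t v) (at v)"
proof -
  have "((\<lambda>z. A0 / r t * exp (of_real pi * z\<^sup>2 / a t)) has_field_derivative
      A0 / r t * (exp (of_real pi * (\<zeta> v)\<^sup>2 / a t) * (of_real pi * (2 * \<zeta> v) / a t))) (at (\<zeta> v))"
    using a_nz[of t] r_nz[of t] by (auto intro!: derivative_eq_intros simp: field_simps)
  from field_vector_diff_chain_at[OF has_vector_derivative_\<zeta> this]
  show ?thesis
    unfolding k_def[abs_def] kd_def comp_def r2[symmetric] power3_eq_cube power2_eq_square
    by (simp add: mult_ac)
qed

lemma continuous_on_a: "continuous_on S a"
  unfolding a_def by (intro continuous_intros)

lemma continuous_on_kd: "continuous_on S (\<lambda>(v, t). kd t v)"
  unfolding kd_def split_beta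
  by (intro continuous_intros continuous_on_compose2[OF continuous_on_r[of UNIV]]
      continuous_on_compose2[OF continuous_on_\<zeta>[of UNIV]] continuous_on_compose2[OF continuous_on_a[of UNIV]])
    (auto simp: r_nz a_nz)

lemma continuous_on_k: "continuous_on S (\<lambda>t. k t v)"
  unfolding k_def
  by (intro continuous_intros continuous_on_r continuous_on_a) (auto simp: r_nz a_nz)

text \<open>This identity, \<open>k\<^sub>t'(v) \<propto> g(v) d/dt E(\<theta>(t) \<zeta>(v))\<close> with \<open>E\<close> the error function, is the reason for
  the choice of \<open>\<theta>\<close>: integrated over \<open>t\<close> it turns the transform of a Gaussian step into \<open>\<phi> g\<close>.\<close>
lemma kd_eq:
  "of_real (sqrt L) / (2 * of_real pi * \<i>) * kd t v
    = g v * ((\<zeta> v * (of_real (sqrt L) * csqrt w / (r t)^3)) * exp (- (of_real pi * (\<theta> t * \<zeta> v)\<^sup>2)))"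
proof -
  have "of_real pi * (\<zeta> v)\<^sup>2 / w + - (of_real pi * (\<theta> t * \<zeta> v)\<^sup>2) = of_real pi * (\<zeta> v)\<^sup>2 / a t"
  proof -
    have "1 / w - of_real (t\<^sup>2 * L) / (w * a t) = 1 / a t"
    proof -
      have "1 / w - of_real (t\<^sup>2 * L) / (w * a t) = (a t - of_real (t\<^sup>2 * L)) / (w * a t)"
        using w_nz a_nz[of t] by (simp add: diff_divide_distrib)
      also have "a t - of_real (t\<^sup>2 * L) = w" by (simp add: a_def)
      finally show ?thesis using w_nz by simp
    qed
    then have "of_real pi * (\<zeta> v)\<^sup>2 * (1 / w - of_real (t\<^sup>2 * L) / (w * a t)) = of_real pi * (\<zeta> v)\<^sup>2 * (1 / a t)"
      by simp
    then show ?thesis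
      unfolding power_mult_distrib \<theta>2 by (simp add: right_diff_distrib mult_ac)
  qed
  then have "exp (of_real pi * (\<zeta> v)\<^sup>2 / a t) = exp (of_real pi * (\<zeta> v)\<^sup>2 / w) * exp (- (of_real pi * (\<theta> t * \<zeta> v)\<^sup>2))"
    by (simp only: exp_add[symmetric])
  then show ?thesis
    unfolding kd_def g_def using w_nz by (simp add: field_simps)
qed

text \<open>The integrand is the derivative of the error function along the path
  \<open>\<theta> t * \<zeta> v\<close>, which starts at 0.\<close>

lemma integral_\<phi>:
  "((\<lambda>t. (\<zeta> v * (of_real (sqrt L) * csqrt w / (r t)^3)) * exp (- (of_real pi * (\<theta> t * \<zeta> v)\<^sup>2))) has_integral \<phi> v) (cbox 0 1)"
proof -
  have "((\<lambda>t. (\<zeta> v * (of_real (sqrt L) * csqrt w / (r t)^3)) * exp (- (of_real pi * (\<theta> t * \<zeta> v)\<^sup>2))) has_integral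
      gauss_primitive (\<theta> 1 * \<zeta> v) - gauss_primitive (\<theta> 0 * \<zeta> v)) {0..1}"
  proof (rule fundamental_theorem_of_calculus)
    fix t :: real
    have "((\<lambda>t. \<theta> t * \<zeta> v) has_vector_derivative \<zeta> v * (of_real (sqrt L) * csqrt w / (r t)^3)) (at t)"
      using has_vector_derivative_mult_left[OF has_vector_derivative_\<theta>, of "\<zeta> v" t] by (simp add: mult_ac)
    from field_vector_diff_chain_at[OF this has_field_derivative_gauss_primitive]
    show "((\<lambda>t. gauss_primitive (\<theta> t * \<zeta> v)) has_vector_derivative
      (\<zeta> v * (of_real (sqrt L) * csqrt w / (r t)^3)) * exp (- (of_real pi * (\<theta> t * \<zeta> v)\<^sup>2))) (at t within {0..1})"
      unfolding comp_def by (rule has_vector_derivative_at_within)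
  qed simp
  then show ?thesis by (simp add: \<phi>_def \<theta>_def)
qed

text \<open>Differentiating under the \<open>t\<close> integral gives \<open>kd\<close>; by
  \<open>kd_eq\<close> the factor \<open>g v\<close> comes out and the remaining integral is
  \<open>\<phi> v\<close>.\<close>

lemma has_vector_derivative_\<Psi>: "(\<Psi> has_vector_derivative g v * \<phi> v) (at v)"
proof -
  have "((\<lambda>v. integral (cbox 0 1) (\<lambda>t. k t v)) has_vector_derivative integral (cbox 0 1) (\<lambda>t. kd t v)) (at v within UNIV)"
  proof (rule leibniz_rule_vector_derivative)
    show "(\<lambda>t. k t v) integrable_on cbox 0 1" for v
      by (intro integrable_continuous continuous_on_k)
  qed (auto intro: has_vector_derivative_k continuous_on_kd)
  then have "(\<Psi> has_vector_derivative of_real (sqrt L) / (2 * of_real pi * \<i>) * integral (cbox 0 1) (\<lambda>t. kd t v)) (at v)"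
    unfolding \<Psi>_def[abs_def] by (intro has_vector_derivative_mult_right) simp
  also have "of_real (sqrt L) / (2 * of_real pi * \<i>) * integral (cbox 0 1) (\<lambda>t. kd t v)
      = integral (cbox 0 1) (\<lambda>t. g v * ((\<zeta> v * (of_real (sqrt L) * csqrt w / (r t)^3)) * exp (- (of_real pi * (\<theta> t * \<zeta> v)\<^sup>2))))"
    unfolding kd_eq[symmetric] by (rule integral_mult_right[symmetric])
  also have "\<dots> = g v * \<phi> v"
    using integral_\<phi>[of v] by (subst integral_mult_right) (simp add: integral_unique)
  finally show ?thesis .
qed

definition B0 :: real where
  "B0 = sqrt L / (2 * pi) * cmod A0"

text \<open>A positive lower bound for the real part of \<open>1 / a t\<close> over \<open>t\<close>
  in [0, 1]. It serves only the decay of \<Psi> at infinity, so it may deteriorate as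
  \<open>L\<close> grows.\<close>

definition \<eta> :: real where
  "\<eta> = 1 / ((1 + L)\<^sup>2 + L\<^sup>2)"

lemma norm_k_le:
  assumes "t \<in> {0..1}"
  shows "cmod (k t v) \<le> cmod A0 * exp (pi * (1 + 2 * \<bar>v - L * x\<bar> - \<eta> * (v - L * x)\<^sup>2))"
proof -
  define u where "u = v - L * x"
  define p where "p = 1 + t\<^sup>2 * L"
  have t: "t\<^sup>2 \<le> 1" using assms by (simp add: power_le_one)
  have p: "1 \<le> p" "p \<le> 1 + L"
    using L0 t by (simp_all add: p_def)
  have D: "p\<^sup>2 + L\<^sup>2 > 0" using p by (simp add: add_pos_nonneg)
  have a: "a t = Complex p (- L)" by (simp add: a_eq p_def)
  have z: "(\<zeta> v)\<^sup>2 = Complex (x\<^sup>2 - u\<^sup>2) (2 * x * u)"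
    by (simp add: \<zeta>_def u_def complex_eq_iff power2_eq_square)
  have "Re ((\<zeta> v)\<^sup>2 / a t) = p / (p\<^sup>2 + L\<^sup>2) * (x\<^sup>2 - u\<^sup>2) - L / (p\<^sup>2 + L\<^sup>2) * (2 * x * u)"
    unfolding a z by (simp add: Re_divide diff_divide_distrib add_divide_distrib algebra_simps)
  moreover have "p / (p\<^sup>2 + L\<^sup>2) * x\<^sup>2 \<le> 1 * 1"
  proof (rule mult_mono)
    have "p \<le> p\<^sup>2" using p by (simp add: power2_eq_square)
    then show "p / (p\<^sup>2 + L\<^sup>2) \<le> 1" using D by (simp add: add_increasing2)
    show "x\<^sup>2 \<le> 1" using x by (simp add: power_le_one)
  qed auto
  moreover have "\<eta> * u\<^sup>2 \<le> p / (p\<^sup>2 + L\<^sup>2) * u\<^sup>2"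
  proof (rule mult_right_mono)
    have "\<eta> \<le> 1 / (p\<^sup>2 + L\<^sup>2)"
      unfolding \<eta>_def using p D by (intro divide_left_mono add_right_mono power_mono mult_pos_pos) (auto intro: add_pos_nonneg)
    also have "\<dots> \<le> p / (p\<^sup>2 + L\<^sup>2)" using p D by (intro divide_right_mono) auto
    finally show "\<eta> \<le> p / (p\<^sup>2 + L\<^sup>2)" .
  qed simp
  moreover have "\<bar>L / (p\<^sup>2 + L\<^sup>2) * (2 * x * u)\<bar> \<le> 1 * (2 * 1 * \<bar>u\<bar>)"
    unfolding abs_mult
  proof (rule mult_mono)
    have "L \<le> L\<^sup>2" using L by (simp add: power2_eq_square)
    then show "\<bar>L / (p\<^sup>2 + L\<^sup>2)\<bar> \<le> 1" using D L0 by (simp add: add_increasing)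
    show "\<bar>2\<bar> * \<bar>x\<bar> * \<bar>u\<bar> \<le> 2 * 1 * \<bar>u\<bar>" using x by (intro mult_right_mono) auto
  qed auto
  ultimately have "Re ((\<zeta> v)\<^sup>2 / a t) \<le> 1 + 2 * \<bar>u\<bar> - \<eta> * u\<^sup>2"
    unfolding right_diff_distrib abs_le_iff by linarith
  then have "pi * Re ((\<zeta> v)\<^sup>2 / a t) \<le> pi * (1 + 2 * \<bar>u\<bar> - \<eta> * u\<^sup>2)"
    by (rule mult_left_mono) simp
  moreover have "Re (of_real pi * (\<zeta> v)\<^sup>2 / a t) = pi * Re ((\<zeta> v)\<^sup>2 / a t)"
  proof -
    have "Re (of_real s * z) = s * Re z" for s z by simp
    then show ?thesis unfolding times_divide_eq_right[symmetric] .
  qed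
  ultimately have "cmod (exp (of_real pi * (\<zeta> v)\<^sup>2 / a t)) \<le> exp (pi * (1 + 2 * \<bar>u\<bar> - \<eta> * u\<^sup>2))"
    unfolding norm_exp_eq_Re by simp
  moreover have "cmod (A0 / r t) \<le> cmod A0"
    using divide_left_mono[OF norm_r[of t], of "cmod A0"] norm_r[of t] r_nz[of t] by (simp add: norm_divide)
  ultimately show ?thesis
    unfolding k_def norm_mult u_def by (intro mult_mono) auto
qed

lemma norm_\<Psi>_le: "cmod (\<Psi> v) \<le> B0 * exp (pi * (1 + 2 * \<bar>v - L * x\<bar> - \<eta> * (v - L * x)\<^sup>2))"
proof -
  have "cmod (integral (cbox 0 1) (\<lambda>t. k t v)) \<le> cmod A0 * exp (pi * (1 + 2 * \<bar>v - L * x\<bar> - \<eta> * (v - L * x)\<^sup>2)) * (1 - 0)"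
    unfolding box_real using norm_k_le by (intro integral_bound continuous_on_k) auto
  then have "sqrt L / (2 * pi) * cmod (integral (cbox 0 1) (\<lambda>t. k t v)) \<le> sqrt L / (2 * pi) * (cmod A0 * exp (pi * (1 + 2 * \<bar>v - L * x\<bar> - \<eta> * (v - L * x)\<^sup>2)))"
    using L0 by (intro mult_left_mono) auto
  then show ?thesis
    unfolding \<Psi>_def B0_def norm_mult norm_divide using L0 by (simp add: mult_ac)
qed

lemma \<Psi>_limits: "(\<Psi> \<longlongrightarrow> 0) at_top" "(\<Psi> \<longlongrightarrow> 0) at_bot"
proof -
  have eta: "\<eta> > 0" unfolding \<eta>_def using L0 by (intro divide_pos_pos add_pos_pos) auto
  have 1: "((\<lambda>v. B0 * exp (pi * (1 + 2 * \<bar>v - L * x\<bar> - \<eta> * (v - L * x)\<^sup>2))) \<longlongrightarrow> 0) at_top"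
    using eta by real_asymp
  have 2: "((\<lambda>v. B0 * exp (pi * (1 + 2 * \<bar>v - L * x\<bar> - \<eta> * (v - L * x)\<^sup>2))) \<longlongrightarrow> 0) at_bot"
    using eta by real_asymp
  show "(\<Psi> \<longlongrightarrow> 0) at_top"
    by (rule Lim_null_comparison[OF _ 1]) (use norm_\<Psi>_le in auto)
  show "(\<Psi> \<longlongrightarrow> 0) at_bot"
    by (rule Lim_null_comparison[OF _ 2]) (use norm_\<Psi>_le in auto)
qed

section \<open>The same antiderivative seen in space: a positive kernel of size 1/y\<close>

definition kern :: "real \<Rightarrow> real \<Rightarrow> complex" where
  "kern t y = exp (- (of_real pi * of_real (t\<^sup>2 * L * y\<^sup>2)))"

text \<open>Here \<open>y * m y\<close> is the Gaussian step
  \<open>gauss_primitive (sqrt L * y)\<close>. Thus \<open>m\<close> is even and positive, equals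
  \<open>sqrt L\<close> at 0, and is comparable to 1/|y| beyond the scale 1 / sqrt L.\<close>

definition m :: "real \<Rightarrow> real" where
  "m y = sqrt L * (LINT t|lborel. indicator {0..1} t * exp (- (pi * (t\<^sup>2 * L * y\<^sup>2))))"

definition \<kappa> :: "real \<Rightarrow> complex" where
  "\<kappa> y = of_real (m y) * chirp w (x + y) / (2 * of_real pi * \<i>)"

lemma chirp_shift: "chirp w (x + y) = A0 * gauss w (- (w * of_real x)) y"
  unfolding chirp_def gauss_def A0_def exp_add[symmetric]
  by (intro arg_cong[of _ _ exp]) (simp add: power2_eq_square algebra_simps)

lemma integrable_chirp_shift: "integrable lborel (\<lambda>y. chirp w (x + y))"
  unfolding chirp_shift using Re_w by (intro integrable_mult_right integrable_gauss) simp

lemma integral_kern: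
  "(LINT y|lborel. chirp w (x + y) * (kern t y * exp (- (2 * of_real pi * \<i> * of_real v * of_real y)))) = k t v"
proof -
  have "chirp w (x + y) * (kern t y * exp (- (2 * of_real pi * \<i> * of_real v * of_real y)))
      = A0 * gauss (a t) (- \<zeta> v) y" for y
    unfolding chirp_def gauss_def kern_def A0_def exp_add[symmetric] \<zeta>_eq a_def
    by (intro arg_cong[of _ _ exp]) (simp add: power2_eq_square algebra_simps)
  moreover have "Re (a t) > 0" using Re_a[of t] by simp
  ultimately show ?thesis
    using integral_gauss[of "a t" "- \<zeta> v"] by (simp add: k_def r_def)
qed

text \<open>Each \<open>k t\<close> is a Fourier transform by \<open>integral_kern\<close>;
  exchanging the integrals over \<open>t\<close> and \<open>y\<close> collects the Gaussians into
  \<open>m\<close>.\<close>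

lemma \<Psi>_eq_fourier: "\<Psi> v = (LINT y|lborel. \<kappa> y * exp (- (2 * of_real pi * \<i> * of_real v * of_real y)))"
proof -
  let ?e = "\<lambda>y. exp (- (2 * of_real pi * \<i> * of_real v * of_real y)) :: complex"
  have "set_integrable lborel {0..1} (\<lambda>t. k t v)"
    by (rule borel_integrable_atLeastAtMost') (rule continuous_on_k)
  from set_borel_integral_eq_integral(2)[OF this]
  have "integral (cbox 0 1) (\<lambda>t. k t v) = (LINT t|lborel. indicator {0..1} t * k t v)"
    by (simp add: set_lebesgue_integral_def scaleR_conv_of_real of_real_indicator)
  also have "\<dots> = (LINT t|lborel. indicator {0..1} t * (LINT y|lborel. chirp w (x + y) * (kern t y * ?e y)))"
    unfolding integral_kern ..
  also have "\<dots> = (LINT y|lborel. chirp w (x + y) * (LINT t|lborel. indicator {0..1} t * (kern t y * ?e y)))"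
  proof (rule Fubini_mult_bounded[OF sigma_finite_lborel sigma_finite_lborel _ integrable_chirp_shift])
    show "integrable lborel (indicator {0..1::real} :: real \<Rightarrow> complex)"
    proof -
      have "integrable lborel (\<lambda>t. complex_of_real (indicator {0..1::real} t))"
        by (intro integrable_of_real integrable_real_indicator) auto
      then show ?thesis by (simp add: of_real_indicator)
    qed
    show "(\<lambda>(t, y). kern t y * ?e y) \<in> borel_measurable (lborel \<Otimes>\<^sub>M lborel)"
      unfolding kern_def by measurable
    show "cmod (kern t y * ?e y) \<le> 1" for t y
      unfolding norm_mult kern_def norm_exp_eq_Re using L0 by simp
  qed
  also have "(\<lambda>y. LINT t|lborel. indicator {0..1} t * (kern t y * ?e y)) = (\<lambda>y. of_real (m y) / of_real (sqrt L) * ?e y)"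
  proof
    fix y
    have "(LINT t|lborel. indicator {0..1} t * (kern t y * ?e y)) = (LINT t|lborel. indicator {0..1} t * kern t y) * ?e y"
      by (simp add: mult.assoc[symmetric])
    also have "(\<lambda>t. indicator {0..1} t * kern t y) = (\<lambda>t. complex_of_real (indicator {0..1} t * exp (- (pi * (t\<^sup>2 * L * y\<^sup>2)))))"
      by (simp add: kern_def exp_of_real[symmetric] of_real_indicator)
    also have "(LINT t|lborel. complex_of_real (indicator {0..1} t * exp (- (pi * (t\<^sup>2 * L * y\<^sup>2))))) = of_real (m y) / of_real (sqrt L)"
      using L0 by (subst integral_complex_of_real) (simp add: m_def)
    finally show "(LINT t|lborel. indicator {0..1} t * (kern t y * ?e y)) = of_real (m y) / of_real (sqrt L) * ?e y" .
  qed
  finally have *: "integral (cbox 0 1) (\<lambda>t. k t v) = (LINT y|lborel. chirp w (x + y) * (of_real (m y) / of_real (sqrt L) * ?e y))" .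
  have "\<Psi> v = (LINT y|lborel. of_real (sqrt L) / (2 * of_real pi * \<i>) * (chirp w (x + y) * (of_real (m y) / of_real (sqrt L) * ?e y)))"
    unfolding \<Psi>_def * by simp
  also have "\<dots> = (LINT y|lborel. \<kappa> y * ?e y)"
    using L0 by (intro Bochner_Integration.integral_cong) (simp_all add: \<kappa>_def)
  finally show ?thesis .
qed

lemma integrable_m: "integrable lborel (\<lambda>t. indicator {0..1} t * exp (- (pi * (t\<^sup>2 * L * y\<^sup>2))))"
proof -
  have "set_integrable lborel {0..1} (\<lambda>t. exp (- (pi * (t\<^sup>2 * L * y\<^sup>2))))"
    by (rule borel_integrable_atLeastAtMost') (intro continuous_intros)
  then show ?thesis by (simp add: set_integrable_def)
qed

lemma borel_measurable_m [measurable]: "m \<in> borel_measurable borel"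
  unfolding m_def by measurable

lemma m_nonneg: "m y \<ge> 0"
  unfolding m_def using L0 by (intro mult_nonneg_nonneg Bochner_Integration.integral_nonneg) auto

lemma m_le: "m y \<le> sqrt L"
proof -
  have "(LINT t|lborel. indicator {0..1} t * exp (- (pi * (t\<^sup>2 * L * y\<^sup>2)))) \<le> (LINT t|lborel. indicator {0..1::real} t)"
  proof (intro integral_mono integrable_m)
    show "indicator {0..1} t * exp (- (pi * (t\<^sup>2 * L * y\<^sup>2))) \<le> indicator {0..1} t" for t
      using L0 by (auto simp: indicator_def)
  qed auto
  also have "\<dots> = 1" by simp
  finally show ?thesis
    unfolding m_def using L0 by (simp add: mult_left_le)
qed

text \<open>Keep only t \<le> 1 / (sqrt L y), a subinterval of [0, 1] by the hypothesis; there the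
  exponent is at least -pi.\<close>

lemma m_ge:
  assumes "1 / sqrt L \<le> y"
  shows "exp (- pi) / y \<le> m y"
proof -
  define c where "c = 1 / (sqrt L * y)"
  have sL: "sqrt L > 0" using L0 by simp
  then have y: "y > 0" using assms by (metis divide_pos_pos less_le_trans zero_less_one)
  have c: "c > 0" "c \<le> 1"
    using assms sL y by (simp_all add: c_def field_simps)
  have "c * exp (- pi) = (LINT t|lborel. exp (- pi) * indicator {0..c} t)"
    using c by simp
  also have "\<dots> \<le> (LINT t|lborel. indicator {0..1} t * exp (- (pi * (t\<^sup>2 * L * y\<^sup>2))))"
  proof (intro integral_mono integrable_m)
    fix t :: real
    show "exp (- pi) * indicator {0..c} t \<le> indicator {0..1} t * exp (- (pi * (t\<^sup>2 * L * y\<^sup>2)))"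
    proof (cases "t \<in> {0..c}")
      case True
      then have "t\<^sup>2 \<le> c\<^sup>2" by (intro power_mono) auto
      then have "t\<^sup>2 * (L * y\<^sup>2) \<le> c\<^sup>2 * (L * y\<^sup>2)"
        using L0 by (intro mult_right_mono) auto
      also have "\<dots> = 1" using L0 y by (simp add: c_def power_divide power_mult_distrib)
      finally have "pi * (t\<^sup>2 * (L * y\<^sup>2)) \<le> pi * 1" by (intro mult_left_mono) auto
      then show ?thesis using True c by (simp add: mult.assoc)
    qed auto
  qed (use c in auto)
  finally have "sqrt L * (c * exp (- pi)) \<le> m y"
    unfolding m_def using sL by (intro mult_left_mono) auto
  then show ?thesis using sL by (simp add: c_def)
qed

text \<open>The integral of 1/y from 1 / sqrt L to 1 is half of ln L: this is the divergence that
  defeats every estimate.\<close>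

lemma integral_m_ge:
  fixes Env :: "real \<Rightarrow> real"
  assumes Env: "integrable lborel Env" "\<And>y. Env y \<ge> 0"
    and c: "c \<ge> 0" "\<And>y. 0 \<le> y \<Longrightarrow> y \<le> 1 \<Longrightarrow> Env y \<ge> c"
  shows "c * exp (- pi) * ln L / 2 \<le> (LINT y|lborel. Env y * m y)"
proof -
  have sL: "sqrt L > 1" using L by simp
  let ?J = "{1 / sqrt L..1}"
  have le: "1 / sqrt L \<le> 1" using sL by simp
  have "has_bochner_integral lborel (\<lambda>y. 1 / y * indicator ?J y) (ln 1 - ln (1 / sqrt L))"
  proof (rule has_bochner_integral_FTC_Icc_real[OF le])
    fix y assume y: "1 / sqrt L \<le> y"
    then have y0: "y > 0" using sL by (metis divide_pos_pos less_le_trans zero_less_one less_trans)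
    then show "(ln has_real_derivative 1 / y) (at y)" by (rule DERIV_ln_divide)
    show "isCont (\<lambda>y. 1 / y) y" using y0 by (intro continuous_intros) auto
  qed
  then have I: "integrable lborel (\<lambda>y. 1 / y * indicator ?J y)"
    and v: "(LINT y|lborel. 1 / y * indicator ?J y) = ln (sqrt L)"
    using sL by (auto simp: has_bochner_integral_iff ln_div)
  have "c * exp (- pi) * ln L / 2 = (LINT y|lborel. c * exp (- pi) * (1 / y * indicator ?J y))"
    unfolding integral_mult_right_zero v using L0 by (simp add: ln_sqrt)
  also have "\<dots> \<le> (LINT y|lborel. Env y * m y)"
  proof (rule integral_mono)
    show "integrable lborel (\<lambda>y. c * exp (- pi) * (1 / y * indicator ?J y))"
      by (rule integrable_mult_right[OF I])
    show "integrable lborel (\<lambda>y. Env y * m y)"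
    proof (rule Bochner_Integration.integrable_bound[where f = "\<lambda>y. sqrt L * Env y"])
      show "AE y in lborel. norm (Env y * m y) \<le> norm (sqrt L * Env y)"
        using Env(2) m_nonneg m_le L0 by (intro AE_I2) (auto simp: abs_mult mult.commute intro!: mult_left_mono)
    qed (use Env in auto)
    fix y
    show "c * exp (- pi) * (1 / y * indicator ?J y) \<le> Env y * m y"
    proof (cases "y \<in> ?J")
      case True
      then have y0: "y \<ge> 0" using sL by (auto intro: order_trans[rotated])
      have "c * (exp (- pi) / y) \<le> Env y * m y"
        using True y0 c Env(2) m_ge by (intro mult_mono) auto
      then show ?thesis using True by simp
    qed (use Env(2) m_nonneg in auto)
  qed
  finally show ?thesis .
qed

lemma integrable_\<kappa>: "integrable lborel \<kappa>"
proof (rule Bochner_Integration.integrable_bound[where f = "\<lambda>y. of_real (sqrt L) * chirp w (x + y)"])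
  show "integrable lborel (\<lambda>y. of_real (sqrt L) * chirp w (x + y))"
    by (intro integrable_mult_right integrable_chirp_shift)
  show "\<kappa> \<in> borel_measurable lborel"
    unfolding \<kappa>_def chirp_def by measurable
  show "AE y in lborel. cmod (\<kappa> y) \<le> cmod (of_real (sqrt L) * chirp w (x + y))"
  proof (rule AE_I2)
    fix y
    have "cmod (\<kappa> y) = m y * cmod (chirp w (x + y)) / (2 * pi)"
      using m_nonneg[of y] by (simp add: \<kappa>_def norm_mult norm_divide)
    also have "\<dots> \<le> m y * cmod (chirp w (x + y)) / 1"
      using m_nonneg[of y] pi_gt3 by (intro divide_left_mono) auto
    also have "\<dots> \<le> sqrt L * cmod (chirp w (x + y))"
      using m_le by (auto intro!: mult_right_mono)
    finally show "cmod (\<kappa> y) \<le> cmod (of_real (sqrt L) * chirp w (x + y))"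
      using L0 by (simp add: norm_mult)
  qed
qed

text \<open>Expanding \<open>(\<zeta> v)\<^sup>2 / w\<close> gives three terms; \<open>A0\<close>
  cancels the first, and the others are the phase at \<open>x\<close> and the transformed
  chirp.\<close>

lemma g_eq_fourier: "g v = fourier (chirp w) v * exp (2 * of_real pi * \<i> * of_real x * of_real v)"
proof -
  have "of_real pi * (\<zeta> v)\<^sup>2 / w = of_real pi * w * (of_real x)\<^sup>2 + 2 * of_real pi * \<i> * of_real x * of_real v
      - of_real pi * (of_real v)\<^sup>2 / w"
    unfolding \<zeta>_eq using w_nz by (simp add: field_simps power2_eq_square)
  then have "A0 * exp (of_real pi * (\<zeta> v)\<^sup>2 / w) = gauss (1 / w) 0 v * exp (2 * of_real pi * \<i> * of_real x * of_real v)"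
    unfolding A0_def gauss_def exp_add[symmetric] by simp
  then show ?thesis
    using Re_w by (simp add: g_def fourier_chirp)
qed

end

section \<open>Failure of the estimates\<close>

lemma integrable_fourier_chirp:
  assumes "Re w > 0"
  shows "integrable lborel (\<lambda>\<xi>. fourier (chirp w) \<xi> * exp (2 * complex_of_real pi * \<i> * of_real x * of_real \<xi>))"
proof -
  have "fourier (chirp w) \<xi> * exp (2 * complex_of_real pi * \<i> * of_real x * of_real \<xi>)
     = gauss (1 / w) (\<i> * of_real x) \<xi> / csqrt w" for \<xi>
    unfolding fourier_chirp[OF assms] gauss_def by (simp add: exp_add[symmetric] algebra_simps)
  then show ?thesis
    using Re_inverse_pos[OF assms] by (simp add: integrable_gauss)
qed

text \<open>Take \<open>c\<close> supported on 1, 2 and n, with the products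
  \<open>c j * \<alpha> j\<close> proportional to the cyclic differences of the three \<alpha>
  values. These differences sum to 0, also when weighted by \<alpha>; the factor \<open>t\<close>
  normalises \<open>c n\<close> to 1.\<close>

lemma degenerate_coefficients:
  fixes \<alpha> :: "nat \<Rightarrow> real"
  assumes n: "n \<ge> 3" and nz: "\<And>j. j \<in> {1..n} \<Longrightarrow> \<alpha> j \<noteq> 0"
    and inj: "\<And>i j. i \<in> {1..n} \<Longrightarrow> j \<in> {1..n} \<Longrightarrow> i \<noteq> j \<Longrightarrow> \<alpha> i \<noteq> \<alpha> j"
  obtains c :: "nat \<Rightarrow> real" where "c n = 1" "(\<Sum>j=1..n. c j * \<alpha> j) = 0" "(\<Sum>j=1..n. c j * (\<alpha> j)\<^sup>2) = 0"
proof -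
  define t where "t = \<alpha> n / (\<alpha> 1 - \<alpha> 2)"
  define c where "c = (\<lambda>j. if j = n then 1 else if j = 1 then t * (\<alpha> 2 - \<alpha> n) / \<alpha> 1
    else if j = 2 then t * (\<alpha> n - \<alpha> 1) / \<alpha> 2 else 0)"
  have nz': "\<alpha> 1 \<noteq> 0" "\<alpha> 2 \<noteq> 0" "\<alpha> n \<noteq> 0" and ne: "\<alpha> 1 - \<alpha> 2 \<noteq> 0"
    using n nz inj[of 1 2] by auto
  have c: "c 1 = t * (\<alpha> 2 - \<alpha> n) / \<alpha> 1" "c 2 = t * (\<alpha> n - \<alpha> 1) / \<alpha> 2" "c n = 1"
    using n by (simp_all add: c_def)
  have tn: "\<alpha> n = t * (\<alpha> 1 - \<alpha> 2)" using ne by (simp add: t_def)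
  have red: "(\<Sum>j=1..n. c j * F j) = c 1 * F 1 + c 2 * F 2 + c n * F n" for F :: "nat \<Rightarrow> real"
  proof -
    have "(\<Sum>j=1..n. c j * F j) = (\<Sum>j\<in>{1, 2, n}. c j * F j)"
      using n by (intro sum.mono_neutral_right) (auto simp: c_def)
    then show ?thesis using n by simp
  qed
  have "(\<Sum>j=1..n. c j * \<alpha> j) = t * (\<alpha> 2 - \<alpha> n) + t * (\<alpha> n - \<alpha> 1) + t * (\<alpha> 1 - \<alpha> 2)"
    unfolding red c using nz' tn by simp
  then have 1: "(\<Sum>j=1..n. c j * \<alpha> j) = 0" by (simp add: algebra_simps)
  have "(\<Sum>j=1..n. c j * (\<alpha> j)\<^sup>2) = t * (\<alpha> 2 - \<alpha> n) * \<alpha> 1 + t * (\<alpha> n - \<alpha> 1) * \<alpha> 2 + t * (\<alpha> 1 - \<alpha> 2) * \<alpha> n"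
    unfolding red c using nz' tn by (simp add: power2_eq_square)
  then have "(\<Sum>j=1..n. c j * (\<alpha> j)\<^sup>2) = 0" by (simp add: algebra_simps)
  with c(3) 1 show thesis by (rule that)
qed

text \<open>The total phase is a quadratic polynomial in \<open>y\<close> whose linear and quadratic
  coefficients vanish by the hypotheses. A phase independent of \<open>y\<close> remains, times a
  positive Gaussian.\<close>

lemma prod_chirp:
  fixes c \<beta> :: "nat \<Rightarrow> real"
  assumes "(\<Sum>j=1..n. c j * \<beta> j) = 0" "(\<Sum>j=1..n. c j * (\<beta> j)\<^sup>2) = 0"
  shows "(\<Prod>j=1..n. chirp (Complex 1 (- L * c j)) (x + y * \<beta> j))
    = cis (pi * L * x\<^sup>2 * (\<Sum>j=1..n. c j)) * of_real (exp (- pi * (\<Sum>j=1..n. (x + y * \<beta> j)\<^sup>2)))"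
proof -
  have "chirp (Complex 1 (- L * s)) z = exp (of_real (- pi * z\<^sup>2) + \<i> * of_real (pi * L * (s * z\<^sup>2)))" for s z
    unfolding chirp_def gauss_def
    by (intro arg_cong[of _ _ exp]) (simp add: complex_eq_iff power2_eq_square)
  then have "(\<Prod>j=1..n. chirp (Complex 1 (- L * c j)) (x + y * \<beta> j))
      = exp (of_real (- pi * (\<Sum>j=1..n. (x + y * \<beta> j)\<^sup>2)) + \<i> * of_real (pi * L * (\<Sum>j=1..n. c j * (x + y * \<beta> j)\<^sup>2)))"
    by (simp add: exp_sum[symmetric] sum.distrib sum_subtractf sum_distrib_left sum_negf)
  also have "(\<Sum>j=1..n. c j * (x + y * \<beta> j)\<^sup>2)
      = x\<^sup>2 * (\<Sum>j=1..n. c j) + 2 * x * y * (\<Sum>j=1..n. c j * \<beta> j) + y\<^sup>2 * (\<Sum>j=1..n. c j * (\<beta> j)\<^sup>2)"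
    unfolding sum_distrib_left sum.distrib[symmetric]
    by (intro sum.cong) (simp_all add: power2_eq_square algebra_simps)
  finally show ?thesis
    unfolding assms mult_zero_right add_0_right exp_add exp_of_real cis_conv_exp by (simp only: mult_ac)
qed

text \<open>The integral of the operator's integrand times \<phi> is estimated twice: from above by
  \<open>K1\<close> times the supremum over \<open>M\<close>, and from below by evaluating it as an
  integral against the positive kernel \<open>m\<close>. \<open>K0\<close> bounds the Gaussian
  envelope on [0, 1].\<close>

lemma nC_lower_bound:
  fixes \<alpha> c :: "nat \<Rightarrow> real"
  assumes n: "n \<ge> 1" and \<alpha>: "\<alpha> n \<noteq> 0" and cn: "c n = 1"
    and c1: "(\<Sum>j=1..n. c j * \<alpha> j) = 0" and c2: "(\<Sum>j=1..n. c j * (\<alpha> j)\<^sup>2) = 0"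
    and L: "L \<ge> 4" and x: "0 \<le> x" "x \<le> 1"
  defines "K0 \<equiv> exp (- pi * (\<Sum>j=1..n. (1 + \<bar>\<alpha> j / \<alpha> n\<bar>)\<^sup>2))"
    and "K1 \<equiv> exp pi + 2 * (sqrt 28 * exp (4 * pi))"
  shows "ennreal (K0 * exp (- pi) / (4 * pi * K1) * ln L) \<le> nC n \<alpha> (\<lambda>j. chirp (Complex 1 (- L * c j))) x"
proof (rule ccontr)
  interpret chirp_cutoff L x using L x by unfold_locales
  interpret P: product_sigma_finite "\<lambda>_::nat. lborel :: real measure" ..
  define f where "f = (\<lambda>j. chirp (Complex 1 (- L * c j)))"
  define A where "A = K0 * exp (- pi) / (4 * pi * K1) * ln L"
  define gj where "gj = (\<lambda>j \<xi>. fourier (f j) \<xi> * exp (2 * complex_of_real pi * \<i> * of_real x * of_real \<xi>))"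
  define H where "H = {\<xi>. 0 < (\<Sum>j=1..n. \<xi> j * \<alpha> j)}"
  define U where "U = (\<lambda>\<xi>. indicator H \<xi> * (\<Prod>j=1..n. gj j (\<xi> j)))"
  define \<beta> where "\<beta> = (\<lambda>j. \<alpha> j / \<alpha> n)"
  define Env where "Env = (\<lambda>y. exp (- pi * (\<Sum>j=1..n. (x + y * \<beta> j)\<^sup>2)))"
  define S where "S = enn2real (nC n \<alpha> f x)"
  have fn: "f n = chirp w" by (simp add: f_def cn w_def)
  have gn: "gj n = g" by (simp add: gj_def fn g_eq_fourier fun_eq_iff)
  have gint: "integrable lborel (gj j)" for j
    unfolding gj_def f_def by (rule integrable_fourier_chirp) simp
  have nn: "n \<in> {1..n}" using n by simp
  have K1: "K1 > 0" unfolding K1_def by (intro add_pos_nonneg) auto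
  assume "\<not> ennreal (K0 * exp (- pi) / (4 * pi * K1) * ln L) \<le> nC n \<alpha> (\<lambda>j. chirp (Complex 1 (- L * c j))) x"
  then have less: "nC n \<alpha> f x < ennreal A" by (simp add: f_def A_def)
  \<comment> \<open>\<open>enn2real\<close> sends infinity to 0, so finiteness is secured first; it
    comes from the negated claim, which is why the argument is by contradiction.\<close>
  then have fin: "nC n \<alpha> f x = ennreal S"
    unfolding S_def by (metis ennreal_enn2real ennreal_less_top less_trans)
  have S0: "S \<ge> 0" by (simp add: S_def)
  have SA: "S < A" using less S0 unfolding fin by (simp add: ennreal_less_iff)
  have Uint: "integrable (lborel_n n) U"
    unfolding U_def H_def by (intro integrable_halfspace_prod gint)
  have I: "cmod (LINT \<xi>:{\<xi> \<in> space (lborel_n n). \<xi> n < M}|lborel_n n. U \<xi>) \<le> S" for M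
  proof -
    have "(LINT \<xi>:{\<xi> \<in> space (lborel_n n). \<xi> n < M}|lborel_n n. U \<xi>)
      = (LINT \<xi>:{\<xi> \<in> space (lborel_n n). (\<Sum>j=1..n. \<xi> j * \<alpha> j) > 0 \<and> \<xi> n < M}|lborel_n n. \<Prod>j=1..n. gj j (\<xi> j))"
      unfolding set_lebesgue_integral_def U_def H_def
      by (intro Bochner_Integration.integral_cong) (auto simp: indicator_def)
    moreover have "ennreal (cmod (LINT \<xi>:{\<xi> \<in> space (lborel_n n). (\<Sum>j=1..n. \<xi> j * \<alpha> j) > 0 \<and> \<xi> n < M}|lborel_n n. \<Prod>j=1..n. gj j (\<xi> j)))
        \<le> nC n \<alpha> f x"
      unfolding nC_def gj_def by (rule SUP_upper) simp
    ultimately show ?thesis using S0 unfolding fin by simp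
  qed
  have \<phi>m: "\<phi> \<in> borel_measurable borel"
    by (intro borel_measurable_continuous_onI continuous_on_\<phi>)
  have "cmod (LINT \<xi>|lborel_n n. U \<xi> * \<phi> (\<xi> n)) \<le> (cmod C + (LINT m|lborel. cmod (\<psi> m))) * S"
  proof (rule bounded_variation_multiplier[OF _ Uint _ integrable_\<psi> \<phi>_eq I])
    show "sigma_finite_measure (lborel_n n)" by (rule P.sigma_finite) simp
    show "(\<lambda>\<xi>. \<xi> n) \<in> borel_measurable (lborel_n n)" by (rule borel_measurable_coordinate[OF nn])
  qed
  also have "\<dots> \<le> K1 * S"
    using norm_C_le integral_norm_\<psi> S0 by (intro mult_right_mono) (auto simp: K1_def)
  finally have upper: "cmod (LINT \<xi>|lborel_n n. U \<xi> * \<phi> (\<xi> n)) \<le> K1 * S" .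
  \<comment> \<open>Exact evaluation of the same integral: integrate out the last frequency, replace
    \<Psi> by its Fourier integral, then invert the remaining transforms.\<close>
  have "(LINT \<xi>|lborel_n n. U \<xi> * \<phi> (\<xi> n))
    = (LINT \<xi>|lborel_n (n - 1). (\<Prod>j=1..n - 1. gj j (\<xi> j)) *
        (LINT v|lborel. (g v * \<phi> v) * indicator {v. 0 < (\<Sum>j=1..n - 1. \<xi> j * \<alpha> j) + v * \<alpha> n} v))"
    unfolding U_def H_def
    using integral_last_coordinate[where g = gj and \<alpha> = \<alpha>, OF n gint \<phi>m norm_\<phi>_le] by (simp add: gn)
  also have "\<dots> = (LINT \<xi>|lborel_n (n - 1). - of_real (sgn (\<alpha> n)) * ((\<Prod>j=1..n - 1. gj j (\<xi> j)) *
        (LINT y|lborel. \<kappa> y * exp (2 * complex_of_real pi * \<i> * of_real y * of_real (\<Sum>j=1..n - 1. \<xi> j * \<beta> j)))))"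
  proof (rule Bochner_Integration.integral_cong[OF refl])
    fix \<xi> :: "nat \<Rightarrow> real"
    let ?s = "\<Sum>j=1..n - 1. \<xi> j * \<alpha> j"
    have "continuous_on UNIV g"
      unfolding g_def by (intro continuous_intros continuous_on_\<zeta>) (auto simp: w_nz)
    then have cont: "continuous_on UNIV (\<lambda>v. g v * \<phi> v)"
      by (intro continuous_on_mult continuous_on_\<phi>)
    have "integrable lborel (\<lambda>v. g v * \<phi> v)"
    proof (rule Bochner_Integration.integrable_bound)
      show "integrable lborel (\<lambda>v. g v * of_real K1)"
        using gint[of n] by (simp add: gn)
      show "(\<lambda>v. g v * \<phi> v) \<in> borel_measurable lborel"
        using borel_measurable_continuous_onI[OF cont] by simp
      show "AE v in lborel. cmod (g v * \<phi> v) \<le> cmod (g v * of_real K1)"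
      proof -
        have "cmod (\<phi> v) \<le> K1" for v using norm_\<phi>_le by (simp add: K1_def)
        then show ?thesis
          using K1 unfolding norm_mult norm_of_real by (intro AE_I2 mult_left_mono) auto
      qed
    qed
    from integral_halfline_derivative[OF has_vector_derivative_\<Psi> cont this \<Psi>_limits \<alpha>, of ?s]
    have "(LINT v|lborel. (g v * \<phi> v) * indicator {v. 0 < ?s + v * \<alpha> n} v) = - of_real (sgn (\<alpha> n)) * \<Psi> (- ?s / \<alpha> n)" .
    also have "\<Psi> (- ?s / \<alpha> n) = (LINT y|lborel. \<kappa> y * exp (2 * complex_of_real pi * \<i> * of_real y * of_real (?s / \<alpha> n)))"
      unfolding \<Psi>_eq_fourier by (simp add: mult_ac)
    also have "?s / \<alpha> n = (\<Sum>j=1..n - 1. \<xi> j * \<beta> j)"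
      by (simp add: \<beta>_def sum_divide_distrib)
    finally show "(\<Prod>j=1..n - 1. gj j (\<xi> j)) * (LINT v|lborel. (g v * \<phi> v) * indicator {v. 0 < ?s + v * \<alpha> n} v)
      = - of_real (sgn (\<alpha> n)) * ((\<Prod>j=1..n - 1. gj j (\<xi> j)) *
        (LINT y|lborel. \<kappa> y * exp (2 * complex_of_real pi * \<i> * of_real y * of_real (\<Sum>j=1..n - 1. \<xi> j * \<beta> j))))"
      by (simp add: mult.left_commute)
  qed
  also have "\<dots> = - of_real (sgn (\<alpha> n)) * (LINT \<xi>|lborel_n (n - 1). (\<Prod>j=1..n - 1. gj j (\<xi> j)) *
        (LINT y|lborel. \<kappa> y * exp (2 * complex_of_real pi * \<i> * of_real y * of_real (\<Sum>j=1..n - 1. \<xi> j * \<beta> j))))"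
    by (rule integral_mult_right_zero)
  also have "(LINT \<xi>|lborel_n (n - 1). (\<Prod>j=1..n - 1. gj j (\<xi> j)) *
        (LINT y|lborel. \<kappa> y * exp (2 * complex_of_real pi * \<i> * of_real y * of_real (\<Sum>j=1..n - 1. \<xi> j * \<beta> j))))
     = (LINT y|lborel. \<kappa> y * (\<Prod>j=1..n - 1. LINT \<xi>|lborel. gj j \<xi> * exp (2 * complex_of_real pi * \<i> * of_real (y * \<beta> j) * of_real \<xi>)))"
    by (intro integral_prod_fourier_superposition gint integrable_\<kappa>) simp
  also have "\<dots> = (LINT y|lborel. cis (pi * L * x\<^sup>2 * (\<Sum>j=1..n. c j)) / (2 * of_real pi * \<i>) * of_real (Env y * m y))"
  proof (rule Bochner_Integration.integral_cong[OF refl])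
    fix y :: real
    have "(LINT \<xi>|lborel. gj j \<xi> * exp (2 * complex_of_real pi * \<i> * of_real (y * \<beta> j) * of_real \<xi>)) = f j (x + y * \<beta> j)" for j
    proof -
      have "gj j \<xi> * exp (2 * complex_of_real pi * \<i> * of_real (y * \<beta> j) * of_real \<xi>)
        = fourier (f j) \<xi> * exp (2 * complex_of_real pi * \<i> * of_real (x + y * \<beta> j) * of_real \<xi>)" for \<xi>
        unfolding gj_def mult.assoc exp_add[symmetric]
        by (simp add: algebra_simps)
      then show ?thesis
        unfolding f_def by (simp only:) (rule inverse_fourier_chirp, simp)
    qed
    then have "\<kappa> y * (\<Prod>j=1..n - 1. LINT \<xi>|lborel. gj j \<xi> * exp (2 * complex_of_real pi * \<i> * of_real (y * \<beta> j) * of_real \<xi>))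
       = of_real (m y) / (2 * of_real pi * \<i>) * (f n (x + y * \<beta> n) * (\<Prod>j=1..n - 1. f j (x + y * \<beta> j)))"
      using \<alpha> by (simp add: \<kappa>_def fn \<beta>_def)
    \<comment> \<open>The chirp inside \<kappa> supplies the missing factor, since
      \<open>\<beta> n = 1\<close>.\<close>
    also have "f n (x + y * \<beta> n) * (\<Prod>j=1..n - 1. f j (x + y * \<beta> j)) = (\<Prod>j=1..n. f j (x + y * \<beta> j))"
      unfolding atLeastAtMost_insert_last[OF n] by (subst prod.insert) (use n in auto)
    also have "\<dots> = cis (pi * L * x\<^sup>2 * (\<Sum>j=1..n. c j)) * of_real (Env y)"
      unfolding f_def Env_def
    proof (rule prod_chirp)
      show "(\<Sum>j=1..n. c j * \<beta> j) = 0"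
        using c1 \<alpha> by (simp add: \<beta>_def flip: sum_divide_distrib)
      show "(\<Sum>j=1..n. c j * (\<beta> j)\<^sup>2) = 0"
        using c2 \<alpha> by (simp add: \<beta>_def power_divide flip: sum_divide_distrib)
    qed
    finally show "\<kappa> y * (\<Prod>j=1..n - 1. LINT \<xi>|lborel. gj j \<xi> * exp (2 * complex_of_real pi * \<i> * of_real (y * \<beta> j) * of_real \<xi>))
       = cis (pi * L * x\<^sup>2 * (\<Sum>j=1..n. c j)) / (2 * of_real pi * \<i>) * of_real (Env y * m y)"
      by simp
  qed
  also have "\<dots> = cis (pi * L * x\<^sup>2 * (\<Sum>j=1..n. c j)) / (2 * of_real pi * \<i>) * of_real (LINT y|lborel. Env y * m y)"
    unfolding integral_mult_right_zero integral_complex_of_real ..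
  finally have eq: "cmod (LINT \<xi>|lborel_n n. U \<xi> * \<phi> (\<xi> n)) = \<bar>LINT y|lborel. Env y * m y\<bar> / (2 * pi)"
    using \<alpha> by (simp add: norm_mult norm_divide sgn_if)
  have "K0 * exp (- pi) * ln L / 2 \<le> (LINT y|lborel. Env y * m y)"
  proof (rule integral_m_ge)
    show "integrable lborel Env"
    proof (rule Bochner_Integration.integrable_bound[OF integrable_chirp_shift])
      show "Env \<in> borel_measurable lborel" unfolding Env_def by measurable
      \<comment> \<open>The summand for j = n alone already gives Gaussian decay in
        \<open>y\<close>.\<close>
      have "(x + y)\<^sup>2 \<le> (\<Sum>j=1..n. (x + y * \<beta> j)\<^sup>2)" for y
        using member_le_sum[of n "{1..n}" "\<lambda>j. (x + y * \<beta> j)\<^sup>2"] nn \<alpha> by (simp add: \<beta>_def)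
      then show "AE y in lborel. norm (Env y) \<le> cmod (chirp w (x + y))"
        by (simp add: Env_def norm_chirp Re_w)
    qed
    show "K0 \<le> Env y" if "0 \<le> y" "y \<le> 1" for y
    proof -
      have "(x + y * \<beta> j)\<^sup>2 \<le> (1 + \<bar>\<alpha> j / \<alpha> n\<bar>)\<^sup>2" for j
      proof (rule power2_le_iff_abs_le[THEN iffD2])
        have "\<bar>x + y * \<beta> j\<bar> \<le> \<bar>x\<bar> + \<bar>y\<bar> * \<bar>\<beta> j\<bar>"
          using abs_triangle_ineq[of x "y * \<beta> j"] by (simp add: abs_mult)
        also have "\<dots> \<le> 1 + 1 * \<bar>\<beta> j\<bar>"
          using x that by (intro add_mono mult_right_mono) auto
        finally show "\<bar>x + y * \<beta> j\<bar> \<le> 1 + \<bar>\<alpha> j / \<alpha> n\<bar>" by (simp add: \<beta>_def)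
      qed simp
      then have "(\<Sum>j=1..n. (x + y * \<beta> j)\<^sup>2) \<le> (\<Sum>j=1..n. (1 + \<bar>\<alpha> j / \<alpha> n\<bar>)\<^sup>2)"
        by (rule sum_mono)
      then show ?thesis unfolding K0_def Env_def by simp
    qed
  qed (auto simp: Env_def K0_def)
  then have "K0 * exp (- pi) * ln L / 2 / (2 * pi) \<le> \<bar>LINT y|lborel. Env y * m y\<bar> / (2 * pi)"
    by (intro divide_right_mono) auto
  then have "K0 * exp (- pi) * ln L / 2 / (2 * pi) \<le> K1 * S"
    using upper eq by linarith
  then have "A \<le> S"
    unfolding A_def using K1 by (simp add: field_simps)
  with SA show False by simp
qed

section \<open>Norms of both sides of a supposed estimate\<close>

lemma enn_powr_mono:
  assumes "u \<le> v" "r \<ge> 0"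
  shows "enn_powr u r \<le> enn_powr v r"
proof (cases "v = \<infinity>")
  case False
  then have "v < \<infinity>" by (simp add: top.not_eq_extremum)
  then have "u < \<infinity>" using assms(1) by (rule le_less_trans[rotated])
  with \<open>v < \<infinity>\<close> assms show ?thesis
    by (auto simp: enn_powr_def intro!: ennreal_leI powr_mono2 enn2real_mono)
qed (simp add: enn_powr_def)

text \<open>The interval [0, 1] has measure 1, so the lower bound passes to every norm without a
  constant, including target exponents below 1.\<close>

lemma Lp_norm_ge:
  assumes P: "0 < P" and A: "A > 0" and F: "\<And>x. 0 \<le> x \<Longrightarrow> x \<le> 1 \<Longrightarrow> ennreal A \<le> F x"
  shows "ennreal A \<le> Lp_norm P F"
proof (cases "P = \<infinity>")
  case True
  have "\<not> (AE x in lborel. x \<notin> {0..1::real})"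
    by (subst AE_iff_measurable[of "{0..1}"]) auto
  moreover have "AE x in lborel. x \<notin> {0..1::real}" if "\<not> ennreal A \<le> esssup lborel F"
    using esssup_AE[of F lborel]
  proof eventually_elim
    case (elim x)
    then show ?case using that F[of x] by (auto dest: order_trans)
  qed
  ultimately show ?thesis using True by (auto simp: Lp_norm_def)
next
  case False
  define p where "p = enn2real P"
  have p: "p > 0" using P False by (simp add: p_def enn2real_positive_iff top.not_eq_extremum)
  have "ennreal A = enn_powr (ennreal (A powr p)) (1 / p)"
    using p A by (simp add: enn_powr_def powr_powr)
  also have "\<dots> \<le> enn_powr (\<integral>\<^sup>+ x. enn_powr (F x) p \<partial>lborel) (1 / p)"
  proof (rule enn_powr_mono)
    have "ennreal (A powr p) = (\<integral>\<^sup>+ x. ennreal (A powr p) * indicator {0..1::real} x \<partial>lborel)"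
      by (subst nn_integral_cmult_indicator) auto
    also have "\<dots> \<le> (\<integral>\<^sup>+ x. enn_powr (F x) p \<partial>lborel)"
    proof (rule nn_integral_mono)
      fix x :: real
      have "ennreal (A powr p) \<le> enn_powr (F x) p" if "x \<in> {0..1}"
        using enn_powr_mono[OF F, of x p] that p A by (auto simp: enn_powr_def)
      then show "ennreal (A powr p) * indicator {0..1} x \<le> enn_powr (F x) p"
        by (auto simp: indicator_def)
    qed
    finally show "ennreal (A powr p) \<le> (\<integral>\<^sup>+ x. enn_powr (F x) p \<partial>lborel)" .
  qed (use p in simp)
  finally show ?thesis using False by (simp add: Lp_norm_def p_def)
qed

lemma Lp_norm_gaussian_finite:
  assumes "1 \<le> p"
  shows "Lp_norm p (\<lambda>x. ennreal (exp (- pi * x\<^sup>2))) < \<infinity>"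
proof (cases "p = \<infinity>")
  case True
  have "esssup lborel (\<lambda>x::real. ennreal (exp (- pi * x\<^sup>2))) \<le> 1"
    by (rule esssup_I) (auto simp: ennreal_le_1)
  then show ?thesis using True by (auto simp: Lp_norm_def intro: le_less_trans)
next
  case False
  define q where "q = enn2real p"
  have "q \<ge> 1"
    using assms False enn2real_mono[of 1 p] by (simp add: q_def top.not_eq_extremum)
  then have q: "q > 0" by simp
  have e: "enn_powr (ennreal (exp (- pi * x\<^sup>2))) q = ennreal (exp (- (pi * q) * x\<^sup>2 + 0 * x))" for x :: real
    by (simp add: enn_powr_def powr_def mult_ac)
  have "(\<integral>\<^sup>+ x. enn_powr (ennreal (exp (- pi * x\<^sup>2))) q \<partial>lborel) = ennreal (LINT x|lborel. exp (- (pi * q) * x\<^sup>2 + 0 * x))"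
    unfolding e using q by (intro nn_integral_eq_integral integrable_real_gaussian) auto
  then show ?thesis
    using False by (simp add: Lp_norm_def q_def enn_powr_def)
qed

theorem theorem1:
  fixes n :: nat and \<alpha> :: "nat \<Rightarrow> real" and q :: "nat \<Rightarrow> rat" and a :: real
  assumes "n \<ge> 3"
    and "\<And>j. j \<in> {1..n} \<Longrightarrow> inverse (\<alpha> j) = a + real_of_rat (q j)"
    and "\<And>i j. i \<in> {1..n} \<Longrightarrow> j \<in> {1..n} \<Longrightarrow> i \<noteq> j \<Longrightarrow> q i \<noteq> q j"
    and "\<And>j. j \<in> {1..n} \<Longrightarrow> real_of_rat (q j) \<noteq> - a"
  shows "satisfies_no_Lp_estimates n (nC n \<alpha>)"
proof -
  \<comment> \<open>As \<open>inverse 0 = 0\<close>, a vanishing \<open>\<alpha> j\<close> would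
    force \<open>q j\<close> to equal \<open>- a\<close>.\<close>
  have nz: "\<alpha> j \<noteq> 0" if "j \<in> {1..n}" for j
    using assms(2)[OF that] assms(4)[OF that] by auto
  have inj: "\<alpha> i \<noteq> \<alpha> j" if "i \<in> {1..n}" "j \<in> {1..n}" "i \<noteq> j" for i j
    using assms(2)[OF that(1)] assms(2)[OF that(2)] assms(3)[OF that] by auto
  obtain c :: "nat \<Rightarrow> real" where c: "c n = 1" "(\<Sum>j=1..n. c j * \<alpha> j) = 0" "(\<Sum>j=1..n. c j * (\<alpha> j)\<^sup>2) = 0"
    by (rule degenerate_coefficients[OF assms(1) nz inj])
  define f where "f = (\<lambda>L j. chirp (Complex 1 (- L * c j)))"
  obtain d where d: "d > 0" "\<And>L x. L \<ge> 4 \<Longrightarrow> 0 \<le> x \<Longrightarrow> x \<le> 1 \<Longrightarrow> ennreal (d * ln L) \<le> nC n \<alpha> (f L) x"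
  proof
    let ?d = "exp (- pi * (\<Sum>j=1..n. (1 + \<bar>\<alpha> j / \<alpha> n\<bar>)\<^sup>2)) * exp (- pi) / (4 * pi * (exp pi + 2 * (sqrt 28 * exp (4 * pi))))"
    show "?d > 0" by (intro divide_pos_pos mult_pos_pos add_pos_pos) auto
    show "ennreal (?d * ln L) \<le> nC n \<alpha> (f L) x" if "L \<ge> 4" "0 \<le> x" "x \<le> 1" for L x
      unfolding f_def by (rule nC_lower_bound) (use assms(1) nz c that in auto)
  qed
  show ?thesis
    unfolding satisfies_no_Lp_estimates_def
  proof (rule notI, elim exE conjE)
    fix p :: "nat \<Rightarrow> ennreal" and C :: real
    assume p: "\<forall>j\<in>{1..n}. 1 \<le> p j"
      and C: "\<forall>f. (\<forall>j\<in>{1..n}. schwartz (f j)) \<longrightarrow> Lp_norm (1 / (\<Sum>j=1..n. 1 / p j)) (nC n \<alpha> f)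
        \<le> ennreal C * (\<Prod>j=1..n. Lp_norm (p j) (\<lambda>x. ennreal (cmod (f j x))))"
    \<comment> \<open>The right-hand side for every chirp tuple at once: the modulus of each chirp
      is the same Gaussian, whatever \<open>L\<close> is.\<close>
    define R where "R = ennreal C * (\<Prod>j=1..n. Lp_norm (p j) (\<lambda>x. ennreal (exp (- pi * x\<^sup>2))))"
    have "(\<Prod>j=1..n. Lp_norm (p j) (\<lambda>x. ennreal (exp (- pi * x\<^sup>2)))) < \<infinity>"
    proof -
      have "(\<Prod>j=1..n. Lp_norm (p j) (\<lambda>x. ennreal (exp (- pi * x\<^sup>2))))
        = (\<Prod>j=1..n. ennreal (enn2real (Lp_norm (p j) (\<lambda>x. ennreal (exp (- pi * x\<^sup>2))))))"
        using Lp_norm_gaussian_finite p by (intro prod.cong) auto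
      then show ?thesis by (simp add: prod_ennreal)
    qed
    then have R: "R < \<infinity>"
      by (simp add: R_def ennreal_mult_less_top)
    define A where "A = enn2real R + 1"
    have A: "A > 0" by (simp add: A_def add_nonneg_pos)
    \<comment> \<open>The exponential makes \<open>d * ln L\<close> exceed the finite bound by at
      least 1, and the maximum with 4 meets the requirement on chirp rates.\<close>
    define L where "L = max 4 (exp (A / d))"
    have "A / d \<le> ln L"
      unfolding L_def by (subst ln_ge_iff) auto
    then have dL: "A \<le> d * ln L" using d(1) by (simp add: field_simps)
    have "ennreal A \<le> Lp_norm (1 / (\<Sum>j=1..n. 1 / p j)) (nC n \<alpha> (f L))"
    proof (rule Lp_norm_ge[OF _ A])
      \<comment> \<open>A finite sum keeps the target exponent positive; in \<open>ennreal\<close>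
        an infinite denominator would give 0.\<close>
      have "(\<Sum>j=1..n. 1 / p j) \<le> (\<Sum>j=1..n. 1)"
        using p by (intro sum_mono) (auto intro!: divide_le_posI_ennreal order.strict_trans2[OF zero_less_one])
      also have "\<dots> < \<infinity>" by (simp add: of_nat_less_top)
      finally show "0 < 1 / (\<Sum>j=1..n. 1 / p j)"
        by (simp add: ennreal_zero_less_divide)
      show "ennreal A \<le> nC n \<alpha> (f L) x" if "0 \<le> x" "x \<le> 1" for x
        using ennreal_leI[OF dL] d(2)[of L x] that by (auto simp: L_def intro: order_trans)
    qed
    also have "\<dots> \<le> ennreal C * (\<Prod>j=1..n. Lp_norm (p j) (\<lambda>x. ennreal (cmod (f L j x))))"
      using C by (rule allE[of _ "f L"]) (auto simp: f_def intro!: schwartz_chirp)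
    also have "\<dots> = R"
      by (simp add: R_def f_def norm_chirp)
    also have "\<dots> = ennreal (enn2real R)" using R by simp
    finally show False by (simp add: A_def)
  qed
qed

end
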